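(* Let $n\ge 1$ for the lattices $A_n$ and $C_n$ and $n\ge 2$ for the lattice $D_n$. The coordinator polynomial of the growth series of the root lattice $A_n$, $C_n$, $D_n$ with respect to the generating set $\mathcal M_{A_n}$, $\mathcal M_{C_n}$, $\mathcal M_{D_n}$, respectively, is equal to the $h$-polynomial of any unimodular triangulation of the respective polytope $\mathcal P_{A_n}$, $\mathcal P_{C_n}$, $\mathcal P_{D_n}$. These polynomials are palindromic and have nonnegative coefficients. More specifically, denoting them by $h_{A_n},h_{C_n},h_{D_n}$, $$h_{A_n}(x)=\sum_{k=0}^n\binom nk^2x^k,\qquad h_{C_n}(x)=\sum_{k=0}^n\binom{2n}{2k}x^k,\qquad h_{D_n}(x)=\sum_{k=0}^n\left[\binom{2n}{2k}-\frac{2k(n-k)}{n-1}\binom nk\right]x^k.$$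
   Context: Lattices: $A_n=\{\mathbf x\in\mathbb Z^{n+1}:\sum_{i=0}^n x_i=0\}$ (coordinates indexed by $0,\dots,n$); $C_n=D_n=\{\mathbf x\in\mathbb Z^n:\sum_i x_i \text{ is even}\}$; all have rank $n$. Generating sets (as monoids): $\mathcal M_{A_n}=\{\mathbf e_i-\mathbf e_j:0\le i\ne j\le n\}$, $\mathcal M_{C_n}=\{\pm2\mathbf e_i:1\le i\le n\}\cup\{\pm\mathbf e_i\pm\mathbf e_j:1\le i\neq j\le n\}$, $\mathcal M_{D_n}=\{\pm\mathbf e_i\pm\mathbf e_j:1\le i\ne j\le n\}$. Root polytopes: $\mathcal P_{A_n}=\operatorname{conv}\mathcal M_{A_n}$, $\mathcal P_{C_n}=\operatorname{conv}\mathcal M_{C_n}$, $\mathcal P_{D_n}=\operatorname{conv}\mathcal M_{D_n}$. Growth series: for a lattice $\mathcal L$ of rank $d$ generated as a monoid by a finite set $\mathcal M=\{\mathbf a_1,\dots,\mathbf a_r\}$, the word length of $\mathbf u\in\mathcal L$ is $\min\sum c_i$ over all expressions $\mathbf u=\sum c_i\mathbf a_i$ with $c_i\in\mathbb Z_{\ge0}$; $S(k)$ is the number of $\mathbf u\in\mathcal L$ of word length $k$; the growth series is $G(x)=\sum_{k\ge0}S(k)x^k$. It has the form $G(x)=h(x)/(1-x)^d$ with $h$ a polynomial of degree at most $d$, called the coordinator polynomial. A unimodular triangulation of a polytope is taken with respect to the corresponding root lattice $\mathcal L$: a triangulation of the polytope with vertices in $\mathcal L$ such that, for each maximal simplex with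 vertices $v_0,\dots,v_n$, the vectors $v_1-v_0,\dots,v_n-v_0$ form a $\mathbb Z$-basis of $\mathcal L$. For a simplicial complex $\Gamma$ of dimension $d$ with $f_i$ faces of dimension $i$ (and $f_{-1}=1$), the $f$- and $h$-polynomials are $f_\Gamma(x)=\sum_{i=-1}^d f_i\,x^{d-i}$ and $h_\Gamma(x)=f_\Gamma(x-1)=\sum_{i=-1}^d f_i\,(x-1)^{d-i}$. Convention: triangulations of the polytope are obtained from triangulations of its boundary by coning from the origin, and this coning is regarded as not affecting the $h$-vector, so the $h$-polynomial of the triangulation of the polytope is identified with that of the underlying triangulation of the boundary. A polynomial $\sum_{k=0}^n c_kx^k$ (of degree $n$) is palindromic if $c_k=c_{n-k}$ for all $k$. *)

theory Defs
  imports "HOL-Analysis.Analysis" "HOL-Computational_Algebra.Computational_Algebra"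
begin

section \<open>Growth series of lattices\<close>

definition word_length :: "'v::real_vector set \<Rightarrow> 'v \<Rightarrow> nat" where
  "word_length M u =
     (LEAST k. \<exists>c :: 'v \<Rightarrow> nat. u = (\<Sum>a\<in>M. real (c a) *\<^sub>R a) \<and> k = (\<Sum>a\<in>M. c a))"

definition growth_series :: "'v::real_vector set \<Rightarrow> 'v set \<Rightarrow> real fps" where
  "growth_series L M = Abs_fps (\<lambda>k. real (card {u \<in> L. word_length M u = k}))"

text \<open>The rank of a (discrete) lattice is the dimension of its real span, \<^term>\<open>dim L\<close>.\<close>

definition is_coordinator_poly :: "'v::real_vector set \<Rightarrow> 'v set \<Rightarrow> real poly \<Rightarrow> bool" where
  "is_coordinator_poly L M h \<longleftrightarrow>
     degree h \<le> dim L \<and> growth_series L M = fps_of_poly h / (1 - fps_X) ^ dim L"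

definition palindromic :: "nat \<Rightarrow> 'a::zero poly \<Rightarrow> bool" where
  "palindromic n p \<longleftrightarrow> degree p = n \<and> (\<forall>k\<le>n. coeff p k = coeff p (n - k))"


section \<open>Simplicial complexes and unimodular triangulations\<close>

text \<open>
  A \<^const>\<open>simplicial_complex\<close> is closed under taking faces, and the empty set is a face of every
  simplex, of affine dimension \<open>-1\<close>.  So a nonempty complex contains the empty
  simplex, and \<open>f_number K (-1) = 1\<close>.
\<close>

definition complex_dim :: "'v::euclidean_space set set \<Rightarrow> int" where
  "complex_dim K = Max (aff_dim ` K)"

definition f_number :: "'v::euclidean_space set set \<Rightarrow> int \<Rightarrow> nat" where
  "f_number K i = card {S \<in> K. aff_dim S = i}"

definition f_poly :: "'v::euclidean_space set set \<Rightarrow> real poly" where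
  "f_poly K = (\<Sum>i\<in>{-1..complex_dim K}. monom (real (f_number K i)) (nat (complex_dim K - i)))"

definition h_poly :: "'v::euclidean_space set set \<Rightarrow> real poly" where
  "h_poly K = f_poly K \<circ>\<^sub>p [:-1, 1:]"

definition triangulates :: "'v::euclidean_space set set \<Rightarrow> 'v set \<Rightarrow> bool" where
  "triangulates K X \<longleftrightarrow> simplicial_complex K \<and> \<Union>K = X"

definition is_Z_basis :: "'v::real_vector set \<Rightarrow> 'v set \<Rightarrow> bool" where
  "is_Z_basis L B \<longleftrightarrow> finite B \<and>
     L = range (\<lambda>c :: 'v \<Rightarrow> int. \<Sum>b\<in>B. of_int (c b) *\<^sub>R b) \<and>
     (\<forall>c :: 'v \<Rightarrow> int. (\<Sum>b\<in>B. of_int (c b) *\<^sub>R b) = 0 \<longrightarrow> (\<forall>b\<in>B. c b = 0))"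

definition vertices :: "'v::real_vector set \<Rightarrow> 'v set" where
  "vertices S = {v. v extreme_point_of S}"

definition unimodular_triangulation ::
    "'v::euclidean_space set \<Rightarrow> 'v set \<Rightarrow> 'v set set \<Rightarrow> bool" where
  "unimodular_triangulation L P T \<longleftrightarrow>
     triangulates T P \<and>
     (\<forall>S\<in>T. vertices S \<subseteq> L) \<and>
     (\<forall>S\<in>T. (\<forall>S'\<in>T. S \<subseteq> S' \<longrightarrow> S' = S) \<longrightarrow>
        (\<forall>v\<^sub>0\<in>vertices S. is_Z_basis L ((\<lambda>v. v - v\<^sub>0) ` (vertices S - {v\<^sub>0}))))"

definition cone_from_origin :: "'v::real_vector set set \<Rightarrow> 'v set set" where
  "cone_from_origin K = K \<union> (\<lambda>S. convex hull (insert 0 S)) ` K"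

text \<open>
  Triangulations of a root polytope are understood to be cones from the origin over triangulations
  of its boundary, and their \<open>h\<close>-polynomial is that of the boundary triangulation \<open>K\<close>.  The boundary
  is the relative one because the polytope of type A lies in a hyperplane.
\<close>

definition coned_unimodular_triangulation ::
    "'v::euclidean_space set \<Rightarrow> 'v set \<Rightarrow> 'v set set \<Rightarrow> 'v set set \<Rightarrow> bool" where
  "coned_unimodular_triangulation L P K T \<longleftrightarrow>
     triangulates K (rel_frontier P) \<and> T = cone_from_origin K \<and> unimodular_triangulation L P T"


section \<open>Root lattices\<close>

text \<open>
  Coordinates are indexed by an arbitrary finite type \<open>'n\<close>: the lattice \<open>A\<^sub>n\<close> is
  \<open>A_lattice\<close> with an index type of \<open>n + 1\<close> elements; for \<open>C\<^sub>n = D\<^sub>n\<close> the index type has \<open>n\<close> elements.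
\<close>

definition A_lattice :: "(real ^ 'n::finite) set" where
  "A_lattice = {x. (\<forall>i. x $ i \<in> \<int>) \<and> (\<Sum>i\<in>UNIV. x $ i) = 0}"

definition D_lattice :: "(real ^ 'n::finite) set" where
  "D_lattice = {x. (\<forall>i. x $ i \<in> \<int>) \<and> (\<exists>m::int. (\<Sum>i\<in>UNIV. x $ i) = 2 * of_int m)}"

definition C_lattice :: "(real ^ 'n::finite) set" where
  "C_lattice = D_lattice"

definition A_generators :: "(real ^ 'n::finite) set" where
  "A_generators = {axis i 1 - axis j 1 | i j. i \<noteq> j}"

definition D_generators :: "(real ^ 'n::finite) set" where
  "D_generators = {s *\<^sub>R axis i 1 + t *\<^sub>R axis j 1 | s t i j. s \<in> {1, -1} \<and> t \<in> {1, -1} \<and> i \<noteq> j}"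

definition C_generators :: "(real ^ 'n::finite) set" where
  "C_generators = {s *\<^sub>R axis i 2 | s i. s \<in> {1, -1}} \<union>
     {s *\<^sub>R axis i 1 + t *\<^sub>R axis j 1 | s t i j. s \<in> {1, -1} \<and> t \<in> {1, -1} \<and> i \<noteq> j}"

abbreviation A_polytope :: "(real ^ 'n::finite) set" where
  "A_polytope \<equiv> convex hull A_generators"

abbreviation C_polytope :: "(real ^ 'n::finite) set" where
  "C_polytope \<equiv> convex hull C_generators"

abbreviation D_polytope :: "(real ^ 'n::finite) set" where
  "D_polytope \<equiv> convex hull D_generators"

end

theory Submission
  imports Defs
begin

text \<open>
  Let \<open>K\<close> be a boundary triangulation whose cone is unimodular. The simplices of \<open>K\<close> span a complete
  fan with unimodular maximal cones, so every lattice point is a unique combination of the vertices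
  of one simplex with positive integer coefficients; all lattice points of the boundary are
  generators, so the word length is the sum of these coefficients. Hence the growth series is
  \<open>\<Sum>\<^sub>S (x / (1 - x))\<^bsup>|S|\<^esup>\<close>, i.e. the coordinator polynomial is the reversal of the \<open>h\<close>-polynomial, and
  it remains to compute the former and to see that it is palindromic.

  The word length is half the 1-norm for A and C, and the maximum of this and the maximum norm for D.
  For A, pairs of nonnegative vectors of sum \<open>k\<close> decompose into their common part and a lattice point,
  which gives \<open>\<Sum>\<^sub>k (n + k choose n)\<^sup>2 x\<^sup>k = G(x) / (1 - x)\<^sup>n\<^sup>+\<^sup>1\<close>; for C, \<open>G(x\<^sup>2)\<close> is the even part of
  \<open>((1 + x) / (1 - x))\<^sup>n\<close>; and for D the numerator for C has to be corrected by \<open>2 n x (1 + x)\<^sup>n\<^sup>-\<^sup>2\<close>.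
\<close>

section \<open>Lattice points and boundary triangulations\<close>

text \<open>The geometry and the counting meet only in the coordinator polynomial. A triangulation
  expresses it as a sum over faces, whose reversal is the h-polynomial. The symmetry that removes
  the reversal could come from the Dehn-Sommerville relations of the boundary sphere; here it is
  read off from explicit coefficients, obtained by counting lattice points with no triangulation in
  sight. The interface between the two sides is a norm with descent: every nonzero lattice point can
  be moved by one generator so that the norm drops by at least 1. Descent serves twice. Iterated, it
  bounds the word length by the norm. Applied once to a lattice point of the polytope, it shows that
  this point is 0 or a generator, which the geometric argument needs. Type D is the hard case. Half
  the 1-norm is too small there: 2 e_i has word length 2, not 1. The factor 2n in its correction
  stands for the n possible dominating coordinates and their two signs; the factor x (1 + x)^(n-2)
  is what remains after the gained vectors cancel part of the lost ones.\<close>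

lemma word_length_le:
  assumes "u = (\<Sum>a\<in>M. real (c a) *\<^sub>R a)"
  shows "word_length M u \<le> (\<Sum>a\<in>M. c a)"
  unfolding word_length_def by (rule Least_le) (use assms in blast)

lemma word_length_attained:
  assumes "u = (\<Sum>a\<in>M. real (c a) *\<^sub>R a)"
  obtains c' where "u = (\<Sum>a\<in>M. real (c' a) *\<^sub>R a)" "word_length M u = (\<Sum>a\<in>M. c' a)"
proof -
  have "\<exists>c'. u = (\<Sum>a\<in>M. real (c' a) *\<^sub>R a) \<and> word_length M u = (\<Sum>a\<in>M. c' a)"
    unfolding word_length_def by (rule LeastI_ex) (use assms in blast)
  then show ?thesis using that by blast
qed

lemma nat_combination_in_convex_hull:
  fixes c :: "'v::real_vector \<Rightarrow> nat"
  assumes "finite V" "sum c V > 0"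
  shows "(1 / real (sum c V)) *\<^sub>R (\<Sum>v\<in>V. real (c v) *\<^sub>R v) \<in> convex hull V"
proof -
  have "(\<Sum>v\<in>V. real (c v) / real (sum c V)) = 1"
    using assms(2) by (simp flip: sum_divide_distrib of_nat_sum)
  then show ?thesis
    unfolding convex_hull_finite[OF assms(1)]
    by (intro CollectI exI[of _ "\<lambda>v. real (c v) / real (sum c V)"])
      (auto simp: scaleR_right.sum intro!: divide_nonneg_nonneg sum_nonneg)
qed

section \<open>Vertices of simplices and carriers of points in a simplicial complex\<close>

lemma simplex_vertices:
  fixes S :: "'v::euclidean_space set"
  assumes "n simplex S"
  shows "finite (vertices S)" "\<not> affine_dependent (vertices S)" "convex hull (vertices S) = S"
    "aff_dim S = int (card (vertices S)) - 1"
proof -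
  obtain C where C: "finite C" "\<not> affine_dependent C" "S = convex hull C"
    using assms by (auto simp: simplex)
  have "vertices S = C"
    unfolding vertices_def C(3) using extreme_point_of_convex_hull_affine_independent[OF C(2)] by auto
  with C show "finite (vertices S)" "\<not> affine_dependent (vertices S)" "convex hull (vertices S) = S"
    by auto
  then show "aff_dim S = int (card (vertices S)) - 1"
    by (metis aff_dim_convex_hull affine_independent_iff_card)
qed

text \<open>Some barycentric coordinates of \<open>y\<close> in a simplex may vanish. The vertices
  with nonzero coordinate span a face, which belongs to \<open>K\<close> because complexes are
  closed under faces, and on it all coordinates are positive.\<close>

lemma simplicial_complex_carrier:
  fixes K :: "'v::euclidean_space set set"
  assumes K: "simplicial_complex K" and y: "y \<in> \<Union>K"
  obtains S c where "S \<in> K" "\<And>v. v \<in> vertices S \<Longrightarrow> 0 < c v" "sum c (vertices S) = (1::real)"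
    "y = (\<Sum>v\<in>vertices S. c v *\<^sub>R v)"
proof -
  obtain S where S: "S \<in> K" "y \<in> S" using y by blast
  then obtain n where n: "n simplex S" using K by (auto simp: simplicial_complex_def)
  note v = simplex_vertices[OF n]
  obtain c where c: "\<And>v. v \<in> vertices S \<Longrightarrow> 0 \<le> c v" "sum c (vertices S) = 1"
    "(\<Sum>v\<in>vertices S. c v *\<^sub>R v) = y"
    using S(2) v(3) convex_hull_finite[OF v(1)] by (smt (verit) mem_Collect_eq)
  define W where "W = {v \<in> vertices S. c v \<noteq> 0}"
  have sub: "W \<subseteq> vertices S" by (auto simp: W_def)
  have "(convex hull W) face_of S"
    using face_of_convex_hull_affine_independent[OF v(2)] sub v(3) by metis
  then have WK: "convex hull W \<in> K" using K S(1) by (auto simp: simplicial_complex_def)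
  have ind: "\<not> affine_dependent W" using v(2) sub affine_dependent_subset by blast
  have vert: "vertices (convex hull W) = W"
    unfolding vertices_def using extreme_point_of_convex_hull_affine_independent[OF ind] by auto
  show ?thesis
  proof (rule that[of "convex hull W" c])
    show "0 < c v" if "v \<in> vertices (convex hull W)" for v
      using that c(1)[of v] by (auto simp only: vert) (auto simp: W_def)
    show "sum c (vertices (convex hull W)) = 1"
      unfolding vert c(2)[symmetric] by (rule sum.mono_neutral_left) (use v(1) in \<open>auto simp: W_def\<close>)
    show "y = (\<Sum>v\<in>vertices (convex hull W). c v *\<^sub>R v)"
      unfolding vert c(3)[symmetric]
      by (rule sum.mono_neutral_right) (use v(1) in \<open>auto simp: W_def\<close>)
  qed (rule WK)
qed

text \<open>The intersection is a face of both simplices and meets both relative interiors; a face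
  that meets the relative interior is the whole simplex.\<close>

lemma simplicial_complex_carrier_unique:
  fixes K :: "'v::euclidean_space set set"
  assumes K: "simplicial_complex K" and S: "S \<in> K" "S' \<in> K"
    and "y \<in> rel_interior S" "y \<in> rel_interior S'"
  shows "S = S'"
proof -
  have "(S \<inter> S') face_of S" "(S' \<inter> S) face_of S'" using K S by (auto simp: simplicial_complex_def)
  moreover have "y \<in> S" "y \<in> S'" using assms rel_interior_subset by blast+
  ultimately show ?thesis
    using assms subset_of_face_of[of "S \<inter> S'" S S] subset_of_face_of[of "S' \<inter> S" S' S'] by blast
qed

section \<open>The polytope of a symmetric generating set\<close>

locale symmetric_generators =
  fixes L M :: "'v::euclidean_space set"
  assumes finite_M: "finite M" and M_nonempty: "M \<noteq> {}"
    and sym: "uminus ` M = M"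
    and word: "\<And>u. u \<in> L \<Longrightarrow> \<exists>c. u = (\<Sum>a\<in>M. real (c a) *\<^sub>R a)"
    \<comment> \<open>Since 0 turns out to be in the relative interior, this makes every lattice
      point of the boundary a generator, in particular every vertex of a boundary
      triangulation.\<close>
    and lattice_points: "L \<inter> convex hull M \<subseteq> insert 0 M"
begin

text \<open>The sum of \<open>M\<close> is its own negative, so 0 is the barycentre of
  \<open>M\<close>, a convex combination with all weights positive.\<close>

lemma zero_rel_interior: "0 \<in> rel_interior (convex hull M)"
proof -
  have "(\<Sum>a\<in>M. a) = (\<Sum>a\<in>uminus ` M. a)" by (simp add: sym)
  also have "\<dots> = - (\<Sum>a\<in>M. a)" by (subst sum.reindex) (auto simp: sum_negf)
  finally have "2 *\<^sub>R (\<Sum>a\<in>M. a) = 0" by (simp add: scaleR_2 eq_neg_iff_add_eq_0)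
  then have "(\<Sum>a\<in>M. a) = 0" by simp
  then have "(\<Sum>a\<in>M. (1 / real (card M)) *\<^sub>R a) = 0" by (simp flip: scaleR_right.sum)
  moreover have "card M > 0" using finite_M M_nonempty by (simp add: card_gt_0_iff)
  ultimately have "0 \<in> {y. \<exists>u. (\<forall>x \<in> M. 0 < u x) \<and> sum u M = 1 \<and> sum (\<lambda>x. u x *\<^sub>R x) M = y}"
    by (intro CollectI exI[of _ "\<lambda>_. 1 / real (card M)"]) auto
  then show ?thesis using explicit_subset_rel_interior_convex_hull_minimal[OF finite_M] by blast
qed

lemma frontier: "L \<inter> rel_frontier (convex hull M) \<subseteq> M"
proof -
  have "closed (convex hull M)"
    by (simp add: finite_M finite_imp_compact compact_convex_hull compact_imp_closed)
  then show ?thesis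
    using lattice_points zero_rel_interior by (auto simp: rel_frontier_def)
qed

lemma shrink_rel_interior:
  assumes "y \<in> convex hull M" "0 \<le> t" "t < 1"
  shows "t *\<^sub>R y \<in> rel_interior (convex hull M)"
  using rel_interior_convex_shrink[OF convex_convex_hull zero_rel_interior assms(1), of "1 - t"] assms
  by (simp add: algebra_simps)

text \<open>A ray from 0 meets the boundary at most once. The contradictions below take the form of
  a boundary point that is a proper shrinking of a point of the polytope.\<close>

lemma shrink_notin_rel_frontier:
  assumes "y \<in> convex hull M" "0 \<le> t" "t < 1"
  shows "t *\<^sub>R y \<notin> rel_frontier (convex hull M)"
  using shrink_rel_interior[OF assms] by (simp add: rel_frontier_def)

lemma ray_hits_rel_frontier:
  assumes "u \<in> L" "u \<noteq> 0"
  obtains t where "t > 0" "t *\<^sub>R u \<in> rel_frontier (convex hull M)"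
proof -
  have "u \<in> span M"
    using word[OF assms(1)] by (metis (no_types, lifting) span_base span_scale span_sum)
  moreover have "0 \<in> affine hull M"
    using zero_rel_interior rel_interior_subset convex_hull_subset_affine_hull by blast
  ultimately have "0 + u \<in> affine hull (convex hull M)"
    by (metis add_0 affine_hull_convex_hull affine_hull_span_0)
  moreover have "bounded (convex hull M)"
    by (simp add: finite_M finite_imp_bounded bounded_convex_hull)
  ultimately show ?thesis
    using ray_to_rel_frontier[OF _ zero_rel_interior _ assms(2)] that by (metis add_0)
qed

text \<open>A vanishing combination of \<open>V\<close> with positive coefficient sum would, added to a large multiple
  of the sum of \<open>V\<close>, produce two points of the frontier on a common ray.\<close>

lemma frontier_simplex_independent:
  assumes V: "finite V" "\<not> affine_dependent V" "convex hull V \<subseteq> rel_frontier (convex hull M)"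
  shows "independent V"
proof
  assume "dependent V"
  then obtain c v where cv: "(\<Sum>v\<in>V. c v *\<^sub>R v) = 0" "v \<in> V" "c v \<noteq> 0"
    using dependent_finite[OF V(1)] by auto
  have "sum c V \<noteq> 0" using cv V(1,2) affine_dependent_explicit_finite by blast
  then obtain c where c: "(\<Sum>v\<in>V. c v *\<^sub>R v) = 0" "sum c V > 0"
  proof (cases "sum c V > 0")
    case False
    then show ?thesis using that[of "\<lambda>v. - c v"] \<open>sum c V \<noteq> 0\<close> cv(1) by (auto simp: sum_negf)
  qed (use cv in blast)
  define t where "t = (\<Sum>v\<in>V. \<bar>c v\<bar>)"
  define w where "w = (\<Sum>v\<in>V. v)"
  define N where "N = real (card V)"
  have N: "N > 0" using V(1) cv(2) by (auto simp: N_def card_gt_0_iff)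
  have tc: "t + c v \<ge> 0" if "v \<in> V" for v
    using member_le_sum[of v V "\<lambda>v. \<bar>c v\<bar>"] that V(1) unfolding t_def by force
  have t0: "t \<ge> 0" by (auto simp: t_def sum_nonneg)
  have "(1/N) *\<^sub>R w \<in> convex hull V"
    unfolding convex_hull_finite[OF V(1)]
    by (rule CollectI, rule exI[of _ "\<lambda>_. 1/N"]) (use N in \<open>auto simp: N_def w_def scaleR_right.sum\<close>)
  then have pP: "(1/N) *\<^sub>R w \<in> convex hull M"
    using V(3) by (auto simp: rel_frontier_def finite_M finite_imp_closed closure_closed finite_imp_compact compact_convex_hull compact_imp_closed)
  \<comment> \<open>The total of the coefficients \<open>t + c v\<close>, which are nonnegative by
    the choice of \<open>t\<close>. After normalisation they give a point of the simplex that is the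
    barycentre shrunk by \<open>t * N / s\<close>, a factor below 1 because \<open>sum c V\<close>
    is positive.\<close>
  define s where "s = t * N + sum c V"
  have s: "s > 0" using N t0 c(2) by (auto simp: s_def intro!: add_nonneg_pos)
  have "(t / s) *\<^sub>R w \<in> convex hull V"
    unfolding convex_hull_finite[OF V(1)]
  proof (rule CollectI, rule exI[of _ "\<lambda>v. (t + c v) / s"], intro conjI ballI)
    show "0 \<le> (t + c v) / s" if "v \<in> V" for v using tc[OF that] s by simp
    show "(\<Sum>v\<in>V. (t + c v) / s) = 1"
      using s by (simp flip: sum_divide_distrib add: sum.distrib s_def N_def mult.commute)
    have "(\<Sum>v\<in>V. ((t + c v) / s) *\<^sub>R v) = (1/s) *\<^sub>R (\<Sum>v\<in>V. t *\<^sub>R v + c v *\<^sub>R v)"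
      by (simp add: scaleR_right.sum scaleR_add_left[symmetric])
    then show "(\<Sum>v\<in>V. ((t + c v) / s) *\<^sub>R v) = (t / s) *\<^sub>R w"
      by (simp add: sum.distrib c(1) w_def scaleR_right.sum)
  qed
  then have "((t * N) / s) *\<^sub>R ((1/N) *\<^sub>R w) \<in> rel_frontier (convex hull M)"
    using V(3) N by auto
  moreover have "t * N / s < 1" "t * N / s \<ge> 0" using s c(2) t0 N by (auto simp: s_def)
  ultimately show False using shrink_notin_rel_frontier[OF pP] by blast
qed

text \<open>The point \<open>u\<close> divided by \<open>sum c V\<close> lies on the boundary. A
  word of smaller length \<open>w\<close> would put \<open>u / w\<close> into the polytope, and
  shrinking that by \<open>w / sum c V\<close> would give the same boundary point.\<close>

lemma frontier_simplex_word_length: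
  fixes c :: "'v \<Rightarrow> nat"
  assumes V: "finite V" "V \<subseteq> L" "convex hull V \<subseteq> rel_frontier (convex hull M)"
    and L: "(\<Sum>v\<in>V. real (c v) *\<^sub>R v) \<in> L"
  shows "word_length M (\<Sum>v\<in>V. real (c v) *\<^sub>R v) = (\<Sum>v\<in>V. c v)"
proof (rule antisym)
  define u where "u = (\<Sum>v\<in>V. real (c v) *\<^sub>R v)"
  have VM: "V \<subseteq> M" using V frontier hull_subset[of V convex] by blast
  have "word_length M u \<le> (\<Sum>a\<in>M. if a \<in> V then c a else 0)"
  proof (rule word_length_le)
    have "(\<Sum>a\<in>M. real (if a \<in> V then c a else 0) *\<^sub>R a) = (\<Sum>a\<in>M. if a \<in> V then real (c a) *\<^sub>R a else 0)"
      by (rule sum.cong) auto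
    also have "\<dots> = u" using VM finite_M by (simp add: u_def sum.If_cases Int_absorb1)
    finally show "u = (\<Sum>a\<in>M. real (if a \<in> V then c a else 0) *\<^sub>R a)" ..
  qed
  also have "\<dots> = sum c V" using VM finite_M by (simp add: sum.If_cases Int_absorb1)
  finally show "word_length M (\<Sum>v\<in>V. real (c v) *\<^sub>R v) \<le> sum c V" by (simp add: u_def)
  show "sum c V \<le> word_length M (\<Sum>v\<in>V. real (c v) *\<^sub>R v)"
  proof (rule ccontr)
    obtain c0 where "u = (\<Sum>a\<in>M. real (c0 a) *\<^sub>R a)" using word L unfolding u_def by blast
    then obtain m where m: "u = (\<Sum>a\<in>M. real (m a) *\<^sub>R a)" "word_length M u = (\<Sum>a\<in>M. m a)"
      by (rule word_length_attained)
    define w where "w = (\<Sum>a\<in>M. m a)"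
    assume "\<not> ?thesis"
    then have less: "w < sum c V" using m(2) by (simp add: u_def w_def)
    have "(1 / real (sum c V)) *\<^sub>R u \<in> convex hull V"
      unfolding u_def using less by (intro nat_combination_in_convex_hull V) auto
    then have fr: "(1 / real (sum c V)) *\<^sub>R u \<in> rel_frontier (convex hull M)" using V by blast
    show False
    proof (cases "w = 0")
      case True
      then have "u = 0" using m(1) finite_M by (simp add: w_def)
      then show False using fr zero_rel_interior by (simp add: rel_frontier_def)
    next
      case False
      have "(1 / real w) *\<^sub>R u \<in> convex hull M"
        unfolding m(1) w_def using False
        by (intro nat_combination_in_convex_hull finite_M) (auto simp: w_def)
      from shrink_notin_rel_frontier[OF this, of "real w / real (sum c V)"] fr less False
      show False by (simp del: of_nat_sum)
    qed
  qed
qed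

end

section \<open>Lattice bases and cones over boundary simplices\<close>

lemma zero_simplex_vertices:
  fixes V :: "'v::euclidean_space set"
  assumes "independent V"
  shows "vertices (convex hull (insert 0 V)) = insert 0 V"
proof -
  have "0 \<notin> V" using assms dependent_zero by blast
  then have "\<not> affine_dependent (insert 0 V)"
    using assms by (simp add: affine_dependent_iff_dependent)
  then show ?thesis
    unfolding vertices_def using extreme_point_of_convex_hull_affine_independent by auto
qed

lemma is_Z_basis_nat_combination:
  fixes L :: "'v::real_vector set"
  assumes B: "is_Z_basis L B" and V: "V \<subseteq> B"
  shows "(\<Sum>v\<in>V. real (c v) *\<^sub>R v) \<in> L"
proof -
  have fin: "finite B" using B by (simp add: is_Z_basis_def)
  have "(\<Sum>v\<in>V. real (c v) *\<^sub>R v) = (\<Sum>v\<in>B. of_int (if v \<in> V then int (c v) else 0) *\<^sub>R v)"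
    by (rule sum.mono_neutral_cong_left) (use fin V in auto)
  then show ?thesis using B by (auto simp: is_Z_basis_def)
qed

text \<open>The given real expansion is compared with the integral one supplied by the basis.
  Independence over the reals is a separate hypothesis because independence over the integers does
  not make real expansions unique, as 1 and sqrt 2 in the real line show.\<close>

lemma is_Z_basis_coefficients_integral:
  fixes L :: "'v::real_vector set"
  assumes B: "is_Z_basis L B" "independent B" and V: "V \<subseteq> B" and v: "v \<in> V"
    and u: "(\<Sum>v\<in>V. c v *\<^sub>R v) \<in> L"
  shows "c v \<in> \<int>"
proof -
  have fin: "finite B" using B by (simp add: is_Z_basis_def)
  obtain z :: "'v \<Rightarrow> int" where z: "(\<Sum>v\<in>V. c v *\<^sub>R v) = (\<Sum>b\<in>B. of_int (z b) *\<^sub>R b)"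
    using B u by (auto simp: is_Z_basis_def)
  have "(\<Sum>v\<in>V. c v *\<^sub>R v) = (\<Sum>v\<in>B. (if v \<in> V then c v else 0) *\<^sub>R v)"
    by (rule sum.mono_neutral_cong_left) (use fin V in auto)
  then have "(\<Sum>b\<in>B. ((if b \<in> V then c b else 0) - of_int (z b)) *\<^sub>R b) = 0"
    using z by (simp add: scaleR_diff_left sum_subtractf)
  then have "(if v \<in> V then c v else 0) - of_int (z v) = 0"
    using V v by (intro independentD[OF B(2) fin order_refl]) auto
  then show ?thesis using v by simp
qed

lemma is_Z_basis_card:
  fixes L :: "'v::euclidean_space set"
  assumes "is_Z_basis L B" "independent B" "B \<subseteq> L"
  shows "card B = dim L"
proof -
  have "L \<subseteq> span B"
    using assms(1) unfolding is_Z_basis_def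
    by (metis (no_types, lifting) image_subsetI span_base span_scale span_sum)
  then show ?thesis using basis_card_eq_dim[of B L] assms by auto
qed

locale coned_triangulation = symmetric_generators L M
  for L M :: "'v::euclidean_space set" +
  fixes K T :: "'v set set"
  assumes coned: "coned_unimodular_triangulation L (convex hull M) K T"
    \<comment> \<open>A nonzero lattice point spans a ray that hits the boundary; so
      \<open>K\<close> is nonempty and contains the empty simplex, which will represent the lattice
      point 0.\<close>
    and nontrivial: "\<exists>u\<in>L. u \<noteq> 0"
begin

lemma K_complex: "simplicial_complex K" and K_union: "\<Union>K = rel_frontier (convex hull M)"
  and T_def: "T = K \<union> (\<lambda>S. convex hull (insert 0 S)) ` K"
  using coned unfolding coned_unimodular_triangulation_def triangulates_def cone_from_origin_def
  by blast+

lemma T_unimodular: "unimodular_triangulation L (convex hull M) T"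
  using coned unfolding coned_unimodular_triangulation_def by blast

lemma T_complex: "simplicial_complex T" and T_vertices: "S \<in> T \<Longrightarrow> vertices S \<subseteq> L"
  using T_unimodular unfolding unimodular_triangulation_def triangulates_def by blast+

lemma K_finite: "finite K"
  using K_complex by (simp add: simplicial_complex_def)

lemma K_vertices:
  assumes "S \<in> K"
  shows "finite (vertices S)" "\<not> affine_dependent (vertices S)" "convex hull (vertices S) = S"
    "aff_dim S = int (card (vertices S)) - 1" "vertices S \<subseteq> L"
    "convex hull (vertices S) \<subseteq> rel_frontier (convex hull M)" "independent (vertices S)"
proof -
  obtain n where "n simplex S" using K_complex assms by (auto simp: simplicial_complex_def)
  note v = simplex_vertices[OF this]
  show "finite (vertices S)" "\<not> affine_dependent (vertices S)" "convex hull (vertices S) = S"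
    "aff_dim S = int (card (vertices S)) - 1" using v by auto
  show "vertices S \<subseteq> L" using T_vertices T_def assms by auto
  show fr: "convex hull (vertices S) \<subseteq> rel_frontier (convex hull M)"
    using K_union assms v(3) by auto
  show "independent (vertices S)" using frontier_simplex_independent[OF v(1,2) fr] .
qed

lemma zero_notin: "S \<in> K \<Longrightarrow> 0 \<notin> S"
  using K_union zero_rel_interior by (auto simp: rel_frontier_def)

text \<open>Unimodularity speaks about maximal simplices of the cone complex only. A maximal simplex
  above the cone over \<open>S\<close> contains 0, so it is itself the cone over some
  \<open>S2\<close> in \<open>K\<close>, and \<open>S\<close> is one of its faces avoiding
  0.\<close>

lemma extends_to_Z_basis:
  assumes S: "S \<in> K"
  obtains S' where "S' \<in> K" "vertices S \<subseteq> vertices S'" "is_Z_basis L (vertices S')"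
    "card (vertices S') = dim L"
proof -
  have "finite T" using T_complex by (simp add: simplicial_complex_def)
  moreover have "convex hull (insert 0 S) \<in> T" using S T_def by auto
  ultimately obtain S1 where S1: "S1 \<in> T" "convex hull (insert 0 S) \<subseteq> S1"
    and max: "\<And>S'. S' \<in> T \<Longrightarrow> S1 \<subseteq> S' \<Longrightarrow> S1 = S'"
    using finite_has_maximal2[of T] by metis
  have sub: "insert 0 S \<subseteq> S1" using S1(2) hull_subset[of "insert 0 S" convex] by blast
  then have "S1 \<notin> K" using zero_notin by blast
  then obtain S2 where S2: "S2 \<in> K" "S1 = convex hull (insert 0 S2)" using S1(1) T_def by auto
  note v = K_vertices[OF S2(1)]
  have "S1 = convex hull (insert 0 (vertices S2))"
    unfolding S2(2) using hull_insert[of convex 0 "vertices S2"] v(3) by simp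
  then have vS1: "vertices S1 = insert 0 (vertices S2)"
    using zero_simplex_vertices[OF v(7)] by simp
  have n0: "0 \<notin> vertices S2" using v(7) dependent_zero by blast
  \<comment> \<open>With 0 as base vertex the edge vectors are the vertices of \<open>S2\<close>
    themselves.\<close>
  have "is_Z_basis L ((\<lambda>w. w - 0) ` (vertices S1 - {0}))"
    using T_unimodular S1(1) max vS1 unfolding unimodular_triangulation_def by blast
  then have Z: "is_Z_basis L (vertices S2)" using vS1 n0 by simp
  have "S1 \<inter> S face_of S1" using T_complex S1(1) S T_def by (auto simp: simplicial_complex_def)
  moreover have "S1 \<inter> S = S" using sub by auto
  ultimately have "S face_of S1" by simp
  then have "vertices S \<subseteq> vertices S1 \<inter> S"
    unfolding vertices_def using extreme_point_of_face[of S S1] by auto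
  then have "vertices S \<subseteq> vertices S2" using vS1 zero_notin[OF S] by auto
  then show ?thesis using that S2(1) Z is_Z_basis_card[OF Z v(7) v(5)] by blast
qed

definition lattice_point :: "'v set \<times> ('v \<Rightarrow> nat) \<Rightarrow> 'v" where
  "lattice_point = (\<lambda>(S, c). \<Sum>v\<in>vertices S. real (c v) *\<^sub>R v)"

text \<open>Coefficient functions are extensional, so a pair is determined by its values on the
  vertices and can be counted. The empty simplex contributes exactly one pair, with lattice point
  0.\<close>

definition positive_combinations :: "('v set \<times> ('v \<Rightarrow> nat)) set" where
  "positive_combinations = (SIGMA S:K. vertices S \<rightarrow>\<^sub>E {1..})"

lemma lattice_point_mem:
  assumes "S \<in> K"
  shows "lattice_point (S, c) \<in> L"
proof -
  obtain S' where "vertices S \<subseteq> vertices S'" "is_Z_basis L (vertices S')"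
    using extends_to_Z_basis[OF assms] .
  then show ?thesis unfolding lattice_point_def using is_Z_basis_nat_combination by simp
qed

lemma word_length_lattice_point:
  "S \<in> K \<Longrightarrow> word_length M (lattice_point (S, c)) = sum c (vertices S)"
  using frontier_simplex_word_length[OF K_vertices(1,5,6), of S c] lattice_point_mem[of S c]
  by (simp add: lattice_point_def)

lemma empty_in_K: "{} \<in> K"
proof -
  obtain u where "u \<in> L" "u \<noteq> 0" using nontrivial by blast
  then obtain t where "t *\<^sub>R u \<in> \<Union>K" using ray_hits_rel_frontier K_union by metis
  then obtain S where "S \<in> K" by blast
  then show ?thesis using K_complex empty_face_of[of S] unfolding simplicial_complex_def by blast
qed

lemma K_full_dimensional: obtains S where "S \<in> K" "card (vertices S) = dim L"
  using extends_to_Z_basis[OF empty_in_K] by blast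

lemma card_vertices_le: "S \<in> K \<Longrightarrow> card (vertices S) \<le> dim L"
  using extends_to_Z_basis card_mono K_vertices(1) by metis

text \<open>Scale \<open>u\<close> to the boundary, expand it with positive coefficients in its
  carrier and scale back. The coefficients are integers because the vertices of the carrier extend
  to a lattice basis.\<close>

lemma lattice_point_surj: "L \<subseteq> lattice_point ` positive_combinations"
proof
  fix u assume u: "u \<in> L"
  show "u \<in> lattice_point ` positive_combinations"
  proof (cases "u = 0")
    case True
    have "vertices {} = ({} :: 'v set)" by (auto simp: vertices_def)
    then show ?thesis using True empty_in_K
      by (intro image_eqI[of _ _ "({}, \<lambda>_. undefined)"])
        (auto simp: lattice_point_def positive_combinations_def)
  next
    case False
    then obtain t where t: "t > 0" "t *\<^sub>R u \<in> \<Union>K"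
      using ray_hits_rel_frontier[OF u] K_union by metis
    obtain S c where S: "S \<in> K" and c: "\<And>v. v \<in> vertices S \<Longrightarrow> 0 < c v"
      "t *\<^sub>R u = (\<Sum>v\<in>vertices S. c v *\<^sub>R v)"
      using simplicial_complex_carrier[OF K_complex t(2)] by metis
    have "u = (1/t) *\<^sub>R (t *\<^sub>R u)" using t by simp
    also have "\<dots> = (\<Sum>v\<in>vertices S. (c v / t) *\<^sub>R v)" unfolding c(2) by (simp add: scaleR_right.sum)
    finally have ueq: "u = (\<Sum>v\<in>vertices S. (c v / t) *\<^sub>R v)" .
    obtain S' where S': "S' \<in> K" "vertices S \<subseteq> vertices S'" "is_Z_basis L (vertices S')"
      using extends_to_Z_basis[OF S] by metis
    have "\<exists>k::nat. k \<ge> 1 \<and> c v / t = real k" if v: "v \<in> vertices S" for v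
    proof -
      have "c v / t \<in> \<int>"
        using is_Z_basis_coefficients_integral[OF S'(3) K_vertices(7)[OF S'(1)] S'(2) v] u ueq
        by simp
      moreover have "c v / t > 0" using c(1)[OF v] t by simp
      ultimately obtain z where "c v / t = of_int z" "z > 0" by (auto elim!: Ints_cases)
      then show ?thesis by (intro exI[of _ "nat z"]) auto
    qed
    then obtain k :: "'v \<Rightarrow> nat" where k: "\<And>v. v \<in> vertices S \<Longrightarrow> k v \<ge> 1 \<and> c v / t = real (k v)"
      by metis
    show ?thesis
    proof (rule image_eqI[of _ _ "(S, restrict k (vertices S))"])
      show "u = lattice_point (S, restrict k (vertices S))"
        unfolding ueq lattice_point_def using k by (auto intro!: sum.cong)
    qed (use S k in \<open>auto simp: positive_combinations_def\<close>)
  qed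
qed

lemma lattice_point_rel_interior:
  assumes S: "S \<in> K" and c: "c \<in> vertices S \<rightarrow>\<^sub>E {1..}" and ne: "S \<noteq> {}"
  shows "(1 / real (sum c (vertices S))) *\<^sub>R lattice_point (S, c) \<in> rel_interior S"
    "sum c (vertices S) > 0"
proof -
  note v = K_vertices[OF S]
  have "vertices S \<noteq> {}" using v(3) ne by auto
  then show pos: "sum c (vertices S) > 0" using v(1) c by (intro sum_pos) (force simp: PiE_iff)+
  have "(\<Sum>v\<in>vertices S. real (c v) / real (sum c (vertices S))) = 1"
    using pos by (simp flip: sum_divide_distrib of_nat_sum)
  moreover have "real (c v) / real (sum c (vertices S)) > 0" if "v \<in> vertices S" for v
    using pos that c by (force simp: PiE_iff simp del: of_nat_sum)
  ultimately have "(1 / real (sum c (vertices S))) *\<^sub>R lattice_point (S, c)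
      \<in> rel_interior (convex hull (vertices S))"
    unfolding rel_interior_convex_hull_explicit[OF v(2)]
    by (intro CollectI exI[of _ "\<lambda>v. real (c v) / real (sum c (vertices S))"])
      (auto simp: lattice_point_def scaleR_right.sum)
  then show "(1 / real (sum c (vertices S))) *\<^sub>R lattice_point (S, c) \<in> rel_interior S"
    using v(3) by simp
qed

text \<open>Both coefficient sums equal the word length of the common point, so both pairs are
  normalised by the same factor. The resulting boundary point lies in the relative interiors of
  \<open>S\<close> and \<open>S'\<close>, which forces \<open>S = S'\<close>; linear independence
  then gives equal coefficients.\<close>

lemma lattice_point_inj: "inj_on lattice_point positive_combinations"
proof (rule inj_onI, clarify)
  fix S c S' c'
  assume "(S, c) \<in> positive_combinations" "(S', c') \<in> positive_combinations"
    and eq: "lattice_point (S, c) = lattice_point (S', c')"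
  then have S: "S \<in> K" "S' \<in> K" and c: "c \<in> vertices S \<rightarrow>\<^sub>E {1..}" "c' \<in> vertices S' \<rightarrow>\<^sub>E {1..}"
    by (auto simp: positive_combinations_def)
  have wl: "sum c (vertices S) = sum c' (vertices S')"
    using word_length_lattice_point S eq by metis
  have z: "sum c (vertices {}) = 0" for c :: "'v \<Rightarrow> nat" by (simp add: vertices_def)
  have "S = {} \<longleftrightarrow> sum c (vertices S) = 0"
    using lattice_point_rel_interior(2)[OF S(1) c(1)] z[of c] by fastforce
  moreover have "S' = {} \<longleftrightarrow> sum c' (vertices S') = 0"
    using lattice_point_rel_interior(2)[OF S(2) c(2)] z[of c'] by fastforce
  ultimately have emp: "S = {} \<longleftrightarrow> S' = {}" using wl by simp
  have SS: "S = S'"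
  proof (cases "S = {}")
    case False
    then show ?thesis
      using simplicial_complex_carrier_unique[OF K_complex S lattice_point_rel_interior(1)[OF S(1) c(1)]]
        lattice_point_rel_interior(1)[OF S(2) c(2)] emp unfolding eq wl by blast
  qed (use emp in simp)
  note v = K_vertices[OF S(1)]
  have "(\<Sum>v\<in>vertices S. (real (c v) - real (c' v)) *\<^sub>R v) = 0"
    using eq unfolding lattice_point_def SS by (simp add: scaleR_diff_left sum_subtractf)
  then have "c v = c' v" if "v \<in> vertices S" for v
    using independentD[OF v(7) v(1) order_refl _ that, of "\<lambda>v. real (c v) - real (c' v)"] by simp
  then show "S = S' \<and> c = c'" using SS c by (auto intro: PiE_ext)
qed

lemma card_word_length:
  "card {u \<in> L. word_length M u = k} =
     (\<Sum>S\<in>K. card {c \<in> vertices S \<rightarrow>\<^sub>E {1..}. (\<Sum>v\<in>vertices S. c v) = k})"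
proof -
  define Z where "Z = (SIGMA S:K. {c \<in> vertices S \<rightarrow>\<^sub>E {1..}. (\<Sum>v\<in>vertices S. c v) = k})"
  have sub: "Z \<subseteq> positive_combinations" by (auto simp: Z_def positive_combinations_def)
  have "{u \<in> L. word_length M u = k} = lattice_point ` Z"
  proof (intro equalityI subsetI)
    fix u assume u: "u \<in> {u \<in> L. word_length M u = k}"
    then have "u \<in> lattice_point ` positive_combinations" using lattice_point_surj by blast
    then obtain S c where "(S, c) \<in> positive_combinations" "u = lattice_point (S, c)" by auto
    then show "u \<in> lattice_point ` Z"
      using u word_length_lattice_point by (auto simp: Z_def positive_combinations_def)
  next
    fix u assume "u \<in> lattice_point ` Z"
    then show "u \<in> {u \<in> L. word_length M u = k}"
      using word_length_lattice_point lattice_point_mem by (auto simp: Z_def)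
  qed
  then have "card {u \<in> L. word_length M u = k} = card Z"
    using card_image[OF inj_on_subset[OF lattice_point_inj sub]] by simp
  also have "\<dots> = (\<Sum>S\<in>K. card {c \<in> vertices S \<rightarrow>\<^sub>E {1..}. (\<Sum>v\<in>vertices S. c v) = k})"
    unfolding Z_def
  proof (rule card_SigmaI[OF K_finite], rule ballI)
    fix S assume S: "S \<in> K"
    have "{c \<in> vertices S \<rightarrow>\<^sub>E {1..}. (\<Sum>v\<in>vertices S. c v) = k} \<subseteq> vertices S \<rightarrow>\<^sub>E {..k}"
      by (auto simp: PiE_iff extensional_def intro!: member_le_sum K_vertices(1)[OF S])
    then show "finite {c \<in> vertices S \<rightarrow>\<^sub>E {1..}. (\<Sum>v\<in>vertices S. c v) = k}"
      using finite_PiE[OF K_vertices(1)[OF S]] by (meson finite_atMost finite_subset)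
  qed
  finally show ?thesis .
qed

end

section \<open>Counting functions by total weight\<close>

lemma fps_count_PiE:
  fixes w :: "'b \<Rightarrow> nat" and I :: "'c set"
  assumes "finite I" and fin: "\<And>s. finite {b \<in> B. w b = s}"
  shows "Abs_fps (\<lambda>s. real (card {f \<in> I \<rightarrow>\<^sub>E B. (\<Sum>i\<in>I. w (f i)) = s})) =
           Abs_fps (\<lambda>s. real (card {b \<in> B. w b = s})) ^ card I"
    and "finite {f \<in> I \<rightarrow>\<^sub>E B. (\<Sum>i\<in>I. w (f i)) = s}"
proof -
  \<comment> \<open>The series identity and finiteness go through one induction: the product formula
    for \<open>card\<close> is available only for finite fibres.\<close>
  define Z where "Z I s = {f \<in> I \<rightarrow>\<^sub>E B. (\<Sum>i\<in>I. w (f i)) = s}" for I :: "'c set" and s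
  have "Abs_fps (\<lambda>s. real (card (Z I s))) = Abs_fps (\<lambda>s. real (card {b \<in> B. w b = s})) ^ card I
     \<and> (\<forall>s. finite (Z I s))"
    using \<open>finite I\<close>
  proof (induction I)
    case empty
    have "Z {} s = (if s = 0 then {\<lambda>_. undefined} else {})" for s by (auto simp: Z_def)
    then show ?case by (auto simp: fps_eq_iff)
  next
    case (insert i I)
    let ?m = "\<lambda>(b, f). f(i := b)"
    \<comment> \<open>The total weight \<open>s\<close> is split by the weight \<open>j\<close> of
      the value at \<open>i\<close>, which produces the Cauchy product. The tag \<open>j\<close> is
      recoverable from the value, so forgetting it by \<open>snd\<close> is injective.\<close>
    define D where "D s = (SIGMA j:{0..s}. {b \<in> B. w b = j} \<times> Z I (s - j))" for s
    have upd: "(\<Sum>k\<in>I. w (if k = i then b else f k)) = (\<Sum>k\<in>I. w (f k))" for b f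
      using insert.hyps by (intro sum.cong) auto
    have sum_upd: "(\<Sum>k\<in>insert i I. w ((f(i := b)) k)) = w b + (\<Sum>k\<in>I. w (f k))" for b f
      using insert.hyps upd by simp
    have memD: "(b, f) \<in> snd ` D s \<longleftrightarrow> b \<in> B \<and> f \<in> I \<rightarrow>\<^sub>E B \<and> w b + (\<Sum>k\<in>I. w (f k)) = s" for b f s
    proof
      assume "b \<in> B \<and> f \<in> I \<rightarrow>\<^sub>E B \<and> w b + (\<Sum>k\<in>I. w (f k)) = s"
      then show "(b, f) \<in> snd ` D s"
        by (intro image_eqI[of _ _ "(w b, (b, f))"]) (auto simp: D_def Z_def)
    qed (auto simp: D_def Z_def)
    have Zeq: "Z (insert i I) s = ?m ` (snd ` D s)" for s
    proof (intro equalityI subsetI)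
      fix g assume "g \<in> Z (insert i I) s"
      then obtain b f where "g = f(i := b)" "b \<in> B" "f \<in> I \<rightarrow>\<^sub>E B" "(\<Sum>k\<in>insert i I. w (g k)) = s"
        unfolding Z_def PiE_insert_eq by auto
      then show "g \<in> ?m ` (snd ` D s)"
        using memD[of b f s] sum_upd[of f b] by (intro image_eqI[of _ _ "(b, f)"]) auto
    next
      fix g assume "g \<in> ?m ` (snd ` D s)"
      then obtain b f where g: "g = f(i := b)" "(b, f) \<in> snd ` D s" by force
      then show "g \<in> Z (insert i I) s"
        using memD[of b f s] sum_upd[of f b] unfolding Z_def PiE_insert_eq by auto
    qed
    have inj1: "inj_on snd (D s)" for s by (auto simp: inj_on_def D_def)
    have inj2: "inj_on ?m (snd ` D s)" for s
      by (rule inj_on_subset[OF inj_combinator[of i I "\<lambda>_. B"]]) (use insert.hyps in \<open>auto simp: D_def Z_def\<close>)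
    have finD: "finite (D s)" for s
      unfolding D_def using fin insert.IH by auto
    have "card (Z (insert i I) s) = (\<Sum>j=0..s. card {b \<in> B. w b = j} * card (Z I (s - j)))" for s
      unfolding Zeq card_image[OF inj2] card_image[OF inj1] unfolding D_def
      using fin insert.IH by (subst card_SigmaI) (auto simp: card_cartesian_product)
    then have "Abs_fps (\<lambda>s. real (card (Z (insert i I) s))) =
      Abs_fps (\<lambda>s. real (card {b \<in> B. w b = s})) * Abs_fps (\<lambda>s. real (card (Z I s)))"
      by (simp add: fps_eq_iff fps_mult_nth)
    then show ?case using insert finD Zeq by simp
  qed
  then show "Abs_fps (\<lambda>s. real (card {f \<in> I \<rightarrow>\<^sub>E B. (\<Sum>i\<in>I. w (f i)) = s})) =
           Abs_fps (\<lambda>s. real (card {b \<in> B. w b = s})) ^ card I"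
    and "finite {f \<in> I \<rightarrow>\<^sub>E B. (\<Sum>i\<in>I. w (f i)) = s}"
    by (auto simp: Z_def)
qed

lemma fps_geometric: "Abs_fps (\<lambda>_. 1) * (1 - fps_X) = (1 :: real fps)"
  using inverse_mult_eq_1'[of "Abs_fps (\<lambda>_. 1 :: real)"] by (simp add: fps_inverse_gp')

lemma one_minus_X_neq_0: "1 - fps_X \<noteq> (0 :: real fps)"
  by (metis fps_geometric mult_zero_right zero_neq_one)

lemma fps_eq_iff_mult_one_minus_X_power:
  fixes F G :: "real fps"
  shows "F * (1 - fps_X) ^ k = G * (1 - fps_X) ^ k \<longleftrightarrow> F = G"
  using one_minus_X_neq_0 by simp

text \<open>The denominator has constant term 1 and is a unit, so the division in
  \<open>is_coordinator_poly\<close> can be traded for a product.\<close>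

lemma growth_series_divide_iff:
  fixes F h :: "real fps"
  shows "F = h / (1 - fps_X) ^ k \<longleftrightarrow> F * (1 - fps_X) ^ k = h"
proof -
  let ?g = "(1 - fps_X :: real fps) ^ k"
  have g0: "fps_nth ?g 0 \<noteq> 0" by (simp add: fps_nth_power_0)
  have "h / ?g = h * inverse ?g" using g0 by (rule fps_divide_unit)
  moreover have inv: "inverse ?g * ?g = 1" using g0 by (rule inverse_mult_eq_1)
  moreover have "F = F * ?g * inverse ?g"
    using inv by (simp only: mult.assoc mult.commute[of ?g] mult_1_right)
  ultimately show ?thesis
    by (auto simp only: mult.assoc mult_1_right)
qed

lemma fps_count_PiE_nat_pos:
  assumes "finite I"
  shows "Abs_fps (\<lambda>s. real (card {f \<in> I \<rightarrow>\<^sub>E {1::nat..}. (\<Sum>i\<in>I. f i) = s})) * (1 - fps_X) ^ card I =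
           fps_X ^ card I"
proof -
  have "{b \<in> {1::nat..}. b = s} = (if s = 0 then {} else {s})" for s by auto
  then have "Abs_fps (\<lambda>s. real (card {b \<in> {1::nat..}. b = s})) = fps_X * Abs_fps (\<lambda>_. 1)"
    by (auto simp: fps_eq_iff)
  then show ?thesis
    using fps_count_PiE(1)[OF assms, of "{1::nat..}" "\<lambda>b. b"] fps_geometric
    by (simp add: power_mult_distrib[symmetric] mult.assoc)
qed

lemma palindromic_poly_inverse:
  fixes h :: "real poly"
  assumes "palindromic d h" "x \<noteq> 0"
  shows "x ^ d * poly h (1 / x) = poly h x"
proof -
  have deg: "degree h = d" and sym: "\<And>k. k \<le> d \<Longrightarrow> coeff h k = coeff h (d - k)"
    using assms(1) unfolding palindromic_def by blast+
  have "coeff (reflect_poly h) k = coeff h k" for k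
    using sym[of k] deg by (cases "k \<le> d") (simp_all add: coeff_reflect_poly coeff_eq_0)
  then have "reflect_poly h = h" by (simp add: poly_eq_iff)
  then show ?thesis
    using poly_reflect_poly_nz[OF assms(2), of h] deg by (simp add: inverse_eq_divide)
qed

section \<open>From the growth series to the h-polynomial\<close>

context coned_triangulation
begin

lemma growth_series_eq:
  "growth_series L M * (1 - fps_X) ^ dim L =
     fps_of_poly (\<Sum>S\<in>K. monom 1 (card (vertices S)) * [:1, -1:] ^ (dim L - card (vertices S)))"
proof -
  let ?F = "\<lambda>S. Abs_fps (\<lambda>k. real (card {c \<in> vertices S \<rightarrow>\<^sub>E {1::nat..}. (\<Sum>v\<in>vertices S. c v) = k}))"
  \<comment> \<open>A simplex with s vertices contributes (x / (1 - x))^s; clearing the denominator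
    (1 - x)^d leaves x^s (1 - x)^(d-s), a polynomial since s is at most d.\<close>
  have F: "?F S * (1 - fps_X) ^ dim L =
      fps_X ^ card (vertices S) * (1 - fps_X) ^ (dim L - card (vertices S))" if S: "S \<in> K" for S
  proof -
    have "(1 - fps_X :: real fps) ^ dim L =
        (1 - fps_X) ^ card (vertices S) * (1 - fps_X) ^ (dim L - card (vertices S))"
      using card_vertices_le[OF S] by (simp flip: power_add)
    then show ?thesis
      by (simp only: fps_count_PiE_nat_pos[OF K_vertices(1)[OF S]] flip: mult.assoc)
  qed
  have "growth_series L M = (\<Sum>S\<in>K. ?F S)"
    by (simp add: growth_series_def card_word_length fps_eq_iff fps_sum_nth)
  then have "growth_series L M * (1 - fps_X) ^ dim L =
     (\<Sum>S\<in>K. fps_X ^ card (vertices S) * (1 - fps_X) ^ (dim L - card (vertices S)))"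
    using F by (simp add: sum_distrib_right)
  moreover have "fps_of_poly [:1, -1:] = (1 - fps_X :: real fps)"
    by (simp add: fps_of_poly_pCons)
  ultimately show ?thesis
    by (simp only: fps_of_poly_sum fps_of_poly_mult fps_of_poly_power fps_of_poly_monom fps_const_1_eq_1 mult_1_left)
qed

lemma complex_dim_K: "complex_dim K = int (dim L) - 1"
proof -
  obtain S where S: "S \<in> K" "card (vertices S) = dim L" by (rule K_full_dimensional)
  show ?thesis
    unfolding complex_dim_def
  proof (rule Max_eqI)
    show "int (dim L) - 1 \<in> aff_dim ` K" using S K_vertices(4)[OF S(1)] by force
    show "y \<le> int (dim L) - 1" if y: "y \<in> aff_dim ` K" for y
    proof -
      obtain S where "S \<in> K" "y = aff_dim S" using y by blast
      then show ?thesis using card_vertices_le[of S] K_vertices(4)[of S] by simp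
    qed
  qed (use K_finite in simp)
qed

text \<open>Faces are regrouped by dimension. A simplex with s vertices has dimension s - 1 and
  \<open>K\<close> has dimension d - 1, so the two shifts by one cancel in the exponent d -
  s.\<close>

lemma poly_h_poly: "poly (h_poly K) x = (\<Sum>S\<in>K. (x - 1) ^ (dim L - card (vertices S)))"
proof -
  let ?g = "\<lambda>S. (x - 1) ^ (dim L - card (vertices S))"
  have "poly (h_poly K) x =
      (\<Sum>i\<in>{-1..int (dim L) - 1}. real (f_number K i) * (x - 1) ^ nat (int (dim L) - 1 - i))"
    by (simp add: h_poly_def f_poly_def complex_dim_K poly_pcompose poly_sum poly_monom)
  also have "\<dots> = (\<Sum>i\<in>{-1..int (dim L) - 1}. \<Sum>S\<in>{S \<in> K. aff_dim S = i}. ?g S)"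
  proof (rule sum.cong[OF refl])
    fix i
    have "(\<Sum>S\<in>{S \<in> K. aff_dim S = i}. ?g S) =
        (\<Sum>S\<in>{S \<in> K. aff_dim S = i}. (x - 1) ^ nat (int (dim L) - 1 - i))"
    proof (rule sum.cong[OF refl], clarify)
      fix S assume "S \<in> K" "i = aff_dim S"
      then have "nat (int (dim L) - 1 - aff_dim S) = dim L - card (vertices S)"
        using K_vertices(4)[of S] by simp
      then show "?g S = (x - 1) ^ nat (int (dim L) - 1 - aff_dim S)" by simp
    qed
    then show "real (f_number K i) * (x - 1) ^ nat (int (dim L) - 1 - i) =
        (\<Sum>S\<in>{S \<in> K. aff_dim S = i}. ?g S)"
      by (simp add: f_number_def)
  qed
  also have "\<dots> = (\<Sum>S\<in>K. ?g S)"
  proof (rule sum.group)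
    show "aff_dim ` K \<subseteq> {-1..int (dim L) - 1}"
    proof (rule image_subsetI)
      fix S assume "S \<in> K"
      then show "aff_dim S \<in> {-1..int (dim L) - 1}"
        using card_vertices_le[of S] K_vertices(4)[of S] by simp
    qed
  qed (simp_all add: K_finite)
  finally show ?thesis .
qed

theorem h_poly_eq_coordinator_poly:
  assumes h: "is_coordinator_poly L M h" and pal: "palindromic (dim L) h"
  shows "h_poly K = h"
proof -
  let ?n = "dim L"
  have "fps_of_poly h =
      fps_of_poly (\<Sum>S\<in>K. monom 1 (card (vertices S)) * [:1, -1:] ^ (?n - card (vertices S)))"
    using h growth_series_eq by (simp add: is_coordinator_poly_def growth_series_divide_iff)
  then have heq: "h = (\<Sum>S\<in>K. monom 1 (card (vertices S)) * [:1, -1:] ^ (?n - card (vertices S)))"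
    by simp
  have eq: "poly (h_poly K) x = poly h x" if x: "x \<noteq> 0" for x
  proof -
    \<comment> \<open>Palindromicity is used here: reversing the face sum turns each x^s (1 -
      x)^(d-s) into (x - 1)^(d-s), the term of the h-polynomial.\<close>
    have "poly h x = x ^ ?n * poly h (1 / x)" using palindromic_poly_inverse[OF pal x] by simp
    also have "\<dots> = (\<Sum>S\<in>K. x ^ ?n * ((1 / x) ^ card (vertices S) * (1 - 1 / x) ^ (?n - card (vertices S))))"
      by (subst heq) (simp add: poly_sum poly_monom poly_power sum_distrib_left)
    also have "\<dots> = (\<Sum>S\<in>K. (x - 1) ^ (?n - card (vertices S)))"
    proof (rule sum.cong[OF refl])
      fix S assume S: "S \<in> K"
      have "x ^ ?n = x ^ card (vertices S) * x ^ (?n - card (vertices S))"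
        using card_vertices_le[OF S] by (simp flip: power_add)
      then have "x ^ ?n * ((1 / x) ^ card (vertices S) * (1 - 1 / x) ^ (?n - card (vertices S))) =
          (x * (1 / x)) ^ card (vertices S) * (x * (1 - 1 / x)) ^ (?n - card (vertices S))"
        unfolding power_mult_distrib by (simp only: mult_ac)
      also have "\<dots> = (x - 1) ^ (?n - card (vertices S))"
        using x by (simp add: right_diff_distrib)
      finally show "x ^ ?n * ((1 / x) ^ card (vertices S) * (1 - 1 / x) ^ (?n - card (vertices S))) =
          (x - 1) ^ (?n - card (vertices S))" .
    qed
    finally show ?thesis by (simp add: poly_h_poly)
  qed
  \<comment> \<open>The comparison excludes x = 0; multiplying by x makes it hold everywhere, and
    the factor is cancelled afterwards.\<close>
  have "poly ([:0, 1:] * h_poly K) = poly ([:0, 1:] * h)"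
  proof
    show "poly ([:0, 1:] * h_poly K) x = poly ([:0, 1:] * h) x" for x
      using eq[of x] by (cases "x = 0") auto
  qed
  then show ?thesis unfolding poly_eq_poly_eq_iff by simp
qed

end

section \<open>Word lengths given by norms\<close>

text \<open>Triangle inequality and norm 1 on \<open>M\<close> bound \<open>N\<close> by the word
  length; \<open>descent\<close> and integrality give the converse by greedy subtraction.
  Homogeneity for real factors is what bounds \<open>N\<close> on the convex hull.\<close>

locale lattice_norm =
  fixes L M :: "'v::euclidean_space set" and N :: "'v \<Rightarrow> real"
  assumes finite_M: "finite M" and M_nonempty: "M \<noteq> {}" and sym: "uminus ` M = M"
    and M_sub: "M \<subseteq> L"
    and diff: "\<And>u a. u \<in> L \<Longrightarrow> a \<in> M \<Longrightarrow> u - a \<in> L"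
    and N_scale: "\<And>t x. t \<ge> 0 \<Longrightarrow> N (t *\<^sub>R x) = t * N x"
    and N_triangle: "\<And>x y. N (x + y) \<le> N x + N y"
    and N_M: "\<And>a. a \<in> M \<Longrightarrow> N a = 1"
    and N_Nats: "\<And>u. u \<in> L \<Longrightarrow> N u \<in> \<nat>"
    and N_zero: "\<And>u. N u = 0 \<Longrightarrow> u = 0"
    and descent: "\<And>u. u \<in> L \<Longrightarrow> u \<noteq> 0 \<Longrightarrow> \<exists>a\<in>M. N (u - a) \<le> N u - 1"
begin

lemma N_0: "N 0 = 0"
  using N_scale[of 0 0] by simp

lemma N_sum_le:
  assumes "finite A"
  shows "N (\<Sum>a\<in>A. real (c a) *\<^sub>R a) \<le> (\<Sum>a\<in>A. real (c a) * N a)"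
  using assms
proof (induction A)
  case (insert a A)
  then show ?case
    using N_triangle[of "real (c a) *\<^sub>R a" "\<Sum>a\<in>A. real (c a) *\<^sub>R a"] by (simp add: N_scale)
qed (simp add: N_0)

lemma short_word:
  "u \<in> L \<Longrightarrow> N u \<le> real k \<Longrightarrow> \<exists>c. u = (\<Sum>a\<in>M. real (c a) *\<^sub>R a) \<and> (\<Sum>a\<in>M. c a) \<le> k"
proof (induction k arbitrary: u)
  case 0
  then have "N u = 0" using N_Nats[of u] by (auto elim!: Nats_cases)
  then show ?case using N_zero by (intro exI[of _ "\<lambda>_. 0"]) auto
next
  case (Suc k)
  show ?case
  proof (cases "u = 0")
    case False
    then obtain a where a: "a \<in> M" "N (u - a) \<le> N u - 1" using descent Suc.prems by blast
    then have "N (u - a) \<le> real k" using Suc.prems by simp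
    then obtain c where c: "u - a = (\<Sum>a\<in>M. real (c a) *\<^sub>R a)" "(\<Sum>a\<in>M. c a) \<le> k"
      using Suc.IH diff a Suc.prems by blast
    let ?c = "\<lambda>b. c b + (if b = a then 1 else 0)"
    have "(\<Sum>b\<in>M. real (?c b) *\<^sub>R b) = (\<Sum>b\<in>M. real (c b) *\<^sub>R b + (if b = a then b else 0))"
      by (rule sum.cong) (auto simp: scaleR_add_left)
    also have "\<dots> = (u - a) + a" using a(1) finite_M unfolding c(1) by (simp add: sum.distrib)
    also have "\<dots> = u" by simp
    finally show ?thesis
      using c(2) a(1) finite_M by (intro exI[of _ ?c]) (simp add: sum.distrib)
  qed (intro exI[of _ "\<lambda>_. 0"], auto)
qed

lemma word_length_eq:
  assumes u: "u \<in> L"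
  shows "real (word_length M u) = N u"
proof -
  obtain k where k: "N u = real k" using N_Nats[OF u] by (auto elim!: Nats_cases)
  then obtain c where c: "u = (\<Sum>a\<in>M. real (c a) *\<^sub>R a)" "(\<Sum>a\<in>M. c a) \<le> k"
    using short_word[OF u, of k] by auto
  obtain c' where c': "u = (\<Sum>a\<in>M. real (c' a) *\<^sub>R a)" "word_length M u = (\<Sum>a\<in>M. c' a)"
    using word_length_attained[OF c(1)] .
  have "N u \<le> (\<Sum>a\<in>M. real (c' a) * N a)" using N_sum_le[OF finite_M] c'(1) by metis
  also have "\<dots> = real (word_length M u)" by (simp add: c'(2) N_M)
  finally show ?thesis using word_length_le[OF c(1)] c(2) k by simp
qed

lemma N_convex_hull: "x \<in> convex hull M \<Longrightarrow> N x \<le> 1"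
proof -
  have "convex {x. N x \<le> 1}"
  proof (rule convexI, simp)
    fix x y and s t :: real assume a: "N x \<le> 1" "N y \<le> 1" "0 \<le> s" "0 \<le> t" "s + t = 1"
    have "N (s *\<^sub>R x + t *\<^sub>R y) \<le> s * N x + t * N y"
      using N_triangle[of "s *\<^sub>R x" "t *\<^sub>R y"] a by (simp add: N_scale)
    also have "\<dots> \<le> s * 1 + t * 1" using a by (intro add_mono mult_left_mono) auto
    finally show "N (s *\<^sub>R x + t *\<^sub>R y) \<le> 1" using a by simp
  qed
  then have "convex hull M \<subseteq> {x. N x \<le> 1}" by (intro hull_minimal) (auto simp: N_M)
  then show "x \<in> convex hull M \<Longrightarrow> N x \<le> 1" by blast
qed

lemma symmetric_generators: "symmetric_generators L M"
proof
  show "\<exists>c. u = (\<Sum>a\<in>M. real (c a) *\<^sub>R a)" if "u \<in> L" for u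
  proof -
    obtain k where "N u = real k" using N_Nats[OF \<open>u \<in> L\<close>] by (auto elim!: Nats_cases)
    then show ?thesis using short_word[OF \<open>u \<in> L\<close>, of k] by auto
  qed
  show "L \<inter> convex hull M \<subseteq> insert 0 M"
  proof
    fix v assume v: "v \<in> L \<inter> convex hull M"
    show "v \<in> insert 0 M"
    proof (cases "v = 0")
      case False
      \<comment> \<open>A nonzero lattice point of the polytope has norm at most 1, so one descent
        step leaves norm at most 0. Norms of lattice points are natural numbers, hence the remainder
        is 0 and \<open>v = a\<close>.\<close>
      then obtain a where a: "a \<in> M" "N (v - a) \<le> N v - 1" using descent v by blast
      then have "N (v - a) \<le> 0" using N_convex_hull v by force
      then have "N (v - a) = 0" using N_Nats[of "v - a"] diff[of v a] a v by (auto elim!: Nats_cases)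
      then show ?thesis using N_zero a by fastforce
    qed simp
  qed
qed (use finite_M M_nonempty sym in auto)

lemma h_poly_eq:
  assumes "is_coordinator_poly L M h" "palindromic (dim L) h"
    and "coned_unimodular_triangulation L (convex hull M) K T"
  shows "h_poly K = h"
proof -
  obtain a where a: "a \<in> M" using M_nonempty by blast
  then have "a \<in> L" "a \<noteq> 0" using M_sub N_M[OF a] N_0 by auto
  then interpret coned_triangulation L M K T
    using symmetric_generators assms(3) by (intro coned_triangulation.intro coned_triangulation_axioms.intro) auto
  show ?thesis using h_poly_eq_coordinator_poly assms by blast
qed

lemma growth_series_norm:
  "growth_series L M = Abs_fps (\<lambda>k. real (card {u \<in> L. N u = real k}))"
proof -
  have "{u \<in> L. word_length M u = k} = {u \<in> L. N u = real k}" for k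
    using word_length_eq by (metis (no_types, lifting) of_nat_eq_iff)
  then show ?thesis by (simp add: growth_series_def)
qed

end

section \<open>Generating functions\<close>

lemma one_plus_X_power_nth: "fps_nth ((1 + fps_X) ^ n) k = real (n choose k)"
  using fps_binomial_of_nat[of n, where 'a=real, symmetric] by (simp add: binomial_gbinomial)

lemma binomial_series: "Abs_fps (\<lambda>k. real (n + k choose n)) * (1 - fps_X) ^ Suc n = 1"
proof (induction n)
  case 0
  then show ?case using fps_geometric by simp
next
  case (Suc n)
  have "Abs_fps (\<lambda>k. real (Suc n + k choose Suc n)) * (1 - fps_X) = Abs_fps (\<lambda>k. real (n + k choose n))"
    by (rule fps_ext) (auto simp: right_diff_distrib not0_implies_Suc gr0_conv_Suc)
  then show ?case using Suc by (simp add: mult.assoc[symmetric])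
qed

text \<open>Both sides satisfy hypergeometric equations in the Euler derivation \<open>T = X d/dX\<close>; multiplication
  by \<open>(1 - X)\<^sup>2\<^sup>n\<^sup>+\<^sup>1\<close> turns one equation into the other (Euler's transformation).\<close>

lemma binomial_square_series:
  "Abs_fps (\<lambda>k. (real (n + k choose n))\<^sup>2) * (1 - fps_X) ^ (2 * n + 1) =
     Abs_fps (\<lambda>k. (real (n choose k))\<^sup>2)"
proof -
  define T where "T = (\<lambda>f :: real fps. fps_X * fps_deriv f)"
  define F where "F = Abs_fps (\<lambda>k. (real (n + k choose n))\<^sup>2)"
  define q where "q = (1 - fps_X :: real fps)"
  define H where "H = q ^ (2 * n + 1) * F"
  \<comment> \<open>What the product rule leaves of \<open>T H\<close> after the common factor
    \<open>q ^ (2 * n)\<close> is taken out.\<close>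
  define G where "G = q * T F - of_nat (2 * n + 1) * fps_X * F"
  have T_nth: "fps_nth (T f) k = real k * fps_nth f k" for f k
    by (cases k) (auto simp: T_def)
  have T_mult: "T (f * g) = f * T g + T f * g" for f g by (simp add: T_def algebra_simps)
  have T_diff: "T (f - g) = T f - T g" for f g by (simp add: T_def algebra_simps)
  have T_X: "T fps_X = fps_X" by (simp add: T_def)
  have T_q: "T q = - fps_X" by (simp add: T_def q_def)
  have T_nat: "T (of_nat m) = 0" for m by (simp add: T_def)
  have T_1: "T 1 = 0" by (simp add: T_def)
  \<comment> \<open>The extra factor \<open>q\<close> avoids the exponent m - 1, which would need a
    case distinction at 0.\<close>
  have T_power: "q * T (q ^ m) = - of_nat m * fps_X * q ^ m" for m
    by (induction m) (simp_all add: T_mult T_q T_1 algebra_simps)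
  have F_rec: "(real (Suc k))\<^sup>2 * fps_nth F (Suc k) = (real (n + 1 + k))\<^sup>2 * fps_nth F k" for k
  proof -
    have "Suc k * (n + Suc k choose n) = (n + 1 + k) * (n + k choose n)"
      using binomial_absorb_comp[of "n + Suc k" n] by simp
    then have "real (Suc k) * real (n + Suc k choose n) = real (n + 1 + k) * real (n + k choose n)"
      by (metis of_nat_mult)
    then show ?thesis unfolding F_def fps_nth_Abs_fps by (metis power_mult_distrib)
  qed
  \<comment> \<open>In operator form T^2 F = X (T + n + 1)^2 F: since T multiplies the k-th
    coefficient by k, this transcribes \<open>F_rec\<close>.\<close>
  have F_ode: "q * T (T F) = fps_X * (of_nat (2 * n + 2) * T F + of_nat ((n + 1)\<^sup>2) * F)"
  proof (rule fps_ext)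
    fix k show "fps_nth (q * T (T F)) k =
        fps_nth (fps_X * (of_nat (2 * n + 2) * T F + of_nat ((n + 1)\<^sup>2) * F)) k"
    proof (cases k)
      case (Suc m)
      show ?thesis
        using F_rec[of m] unfolding Suc q_def
        by (simp add: left_diff_distrib T_nth fps_mult_of_nat_nth del: of_nat_Suc of_nat_add of_nat_power)
          (simp add: algebra_simps power2_eq_square)
    qed (simp add: q_def left_diff_distrib T_nth)
  qed
  have TG: "T G = of_nat (n\<^sup>2) * fps_X * F"
  proof -
    have "T G = q * T (T F) - fps_X * T F - of_nat (2 * n + 1) * (fps_X * F + fps_X * T F)"
      unfolding G_def T_diff T_mult T_q T_nat T_X by (simp add: algebra_simps)
    also have "\<dots> = of_nat (n\<^sup>2) * fps_X * F"
      unfolding F_ode by (simp add: algebra_simps power2_eq_square)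
    finally show ?thesis .
  qed
  have TH: "T H = q ^ (2 * n) * G"
  proof -
    have T_q_power: "T (q ^ (2 * n + 1)) = - of_nat (2 * n + 1) * fps_X * q ^ (2 * n)"
    proof -
      have "q * T (q ^ (2 * n + 1)) = q * (- of_nat (2 * n + 1) * fps_X * q ^ (2 * n))"
        unfolding T_power by (simp add: mult_ac)
      then show ?thesis using one_minus_X_neq_0 by (simp add: q_def)
    qed
    show ?thesis unfolding H_def T_mult T_q_power G_def by (simp add: algebra_simps)
  qed
  \<comment> \<open>In operator form T^2 H = X (T - n)^2 H. The shift n + 1 has become -n, so the
    recursion now has the factor (n - k)^2, as the squared binomials do.\<close>
  have H_ode: "q * T (T H) = of_nat (n\<^sup>2) * fps_X * H - of_nat (2 * n) * fps_X * T H"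
  proof -
    have "q * T (T H) = q ^ (2 * n) * (q * T G) + (q * T (q ^ (2 * n))) * G"
      unfolding TH T_mult by (simp add: algebra_simps)
    also have "\<dots> = of_nat (n\<^sup>2) * fps_X * H - of_nat (2 * n) * fps_X * T H"
      unfolding T_power TG TH by (simp add: H_def algebra_simps)
    finally show ?thesis .
  qed
  have H_rec: "(real (Suc k))\<^sup>2 * fps_nth H (Suc k) = (real n - real k)\<^sup>2 * fps_nth H k" for k
  proof -
    have "fps_nth (q * T (T H)) (Suc k) =
        fps_nth (of_nat (n\<^sup>2) * fps_X * H - of_nat (2 * n) * fps_X * T H) (Suc k)"
      unfolding H_ode ..
    then show ?thesis
      unfolding q_def
      by (simp add: left_diff_distrib T_nth mult.assoc fps_mult_of_nat_nth del: of_nat_Suc of_nat_power)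
        (simp add: algebra_simps power2_eq_square)
  qed
  have "fps_nth H k = (real (n choose k))\<^sup>2" for k
  proof (induction k)
    case 0
    then show ?case by (simp add: H_def F_def q_def fps_nth_power_0)
  next
    case (Suc k)
    have "real (Suc k) * real (n choose Suc k) = (real n - real k) * real (n choose k)"
    proof (cases "k \<le> n")
      case True
      have "Suc k * (n choose Suc k) = (n - k) * (n choose k)"
        by (simp only: binomial_absorption binomial_absorb_comp)
      then show ?thesis using True by (metis of_nat_diff of_nat_mult)
    qed (simp add: binomial_eq_0)
    then have "(real (Suc k))\<^sup>2 * (real (n choose Suc k))\<^sup>2 = (real n - real k)\<^sup>2 * (real (n choose k))\<^sup>2"
      by (metis power_mult_distrib)
    then have "(real (Suc k))\<^sup>2 * fps_nth H (Suc k) = (real (Suc k))\<^sup>2 * (real (n choose Suc k))\<^sup>2"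
      using H_rec[of k] Suc by simp
    then show ?case by simp
  qed
  then show ?thesis by (simp add: fps_eq_iff H_def F_def q_def mult.commute)
qed

text \<open>A factor in X^2 does not mix parities, so on the even-indexed coefficients 1 - X^2 acts
  as 1 - X.\<close>

lemma even_part_mult:
  fixes F :: "real fps"
  shows "Abs_fps (\<lambda>k. fps_nth (F * (1 - fps_X\<^sup>2) ^ m) (2 * k)) = Abs_fps (\<lambda>k. fps_nth F (2 * k)) * (1 - fps_X) ^ m"
proof (induction m)
  case (Suc m)
  have "Abs_fps (\<lambda>k. fps_nth (G * (1 - fps_X\<^sup>2)) (2 * k)) = Abs_fps (\<lambda>k. fps_nth G (2 * k)) * (1 - fps_X)"
    for G :: "real fps"
  proof (rule fps_ext)
    fix k
    show "fps_nth (Abs_fps (\<lambda>k. fps_nth (G * (1 - fps_X\<^sup>2)) (2 * k))) k =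
        fps_nth (Abs_fps (\<lambda>k. fps_nth G (2 * k)) * (1 - fps_X)) k"
      by (cases k) (simp_all add: right_diff_distrib fps_X_power_mult_right_nth)
  qed
  from this[of "F * (1 - fps_X\<^sup>2) ^ m"] Suc show ?case
    by (simp add: mult.assoc mult.commute[of "1 - fps_X"] mult.commute[of "1 - fps_X\<^sup>2"])
qed simp

lemma fps_count_PiE_nat:
  assumes "finite I"
  shows "Abs_fps (\<lambda>s. real (card {f \<in> I \<rightarrow>\<^sub>E (UNIV :: nat set). (\<Sum>i\<in>I. f i) = s})) * (1 - fps_X) ^ card I = 1"
proof -
  have "Abs_fps (\<lambda>s. real (card {b \<in> (UNIV :: nat set). b = s})) = Abs_fps (\<lambda>_. 1)"
    by (simp add: fps_eq_iff)
  then show ?thesis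
    using fps_count_PiE(1)[OF assms, of "UNIV :: nat set" "\<lambda>b. b"] fps_geometric
    by (simp add: power_mult_distrib[symmetric])
qed

lemma nat_abs_fibre: "{b :: int. nat \<bar>b\<bar> = s} = (if s = 0 then {0} else {int s, - int s})"
  by auto

lemma finite_count_PiE_int:
  "finite I \<Longrightarrow> finite {f \<in> I \<rightarrow>\<^sub>E (UNIV :: int set). (\<Sum>i\<in>I. nat \<bar>f i\<bar>) = s}"
  by (rule fps_count_PiE(2)) (simp_all add: nat_abs_fibre)

lemma fps_count_PiE_int:
  assumes "finite I"
  shows "Abs_fps (\<lambda>s. real (card {f \<in> I \<rightarrow>\<^sub>E (UNIV :: int set). (\<Sum>i\<in>I. nat \<bar>f i\<bar>) = s})) *
           (1 - fps_X) ^ card I = (1 + fps_X) ^ card I"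
proof -
  have "card {b \<in> (UNIV :: int set). nat \<bar>b\<bar> = s} = (if s = 0 then 1 else 2)" for s
    by (simp add: nat_abs_fibre)
  then have "Abs_fps (\<lambda>s. real (card {b \<in> (UNIV :: int set). nat \<bar>b\<bar> = s})) * (1 - fps_X) = 1 + fps_X"
    by (auto simp: fps_eq_iff right_diff_distrib)
  then show ?thesis
    using fps_count_PiE(1)[OF assms, of "UNIV :: int set" "\<lambda>b. nat \<bar>b\<bar>"]
    by (simp add: power_mult_distrib[symmetric] nat_abs_fibre)
qed

text \<open>The series for all radii is ((1 + x) / (1 - x))^n. Multiplying by (1 - x^2)^n gives (1 +
  x)^(2n), and the even part of this identity is the claim.\<close>

lemma even_count_series:
  assumes "finite I"
  shows "Abs_fps (\<lambda>k. real (card {f \<in> I \<rightarrow>\<^sub>E (UNIV :: int set). (\<Sum>i\<in>I. nat \<bar>f i\<bar>) = 2 * k})) *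
           (1 - fps_X) ^ card I = Abs_fps (\<lambda>k. real (2 * card I choose (2 * k)))"
proof -
  let ?F = "Abs_fps (\<lambda>s. real (card {f \<in> I \<rightarrow>\<^sub>E (UNIV :: int set). (\<Sum>i\<in>I. nat \<bar>f i\<bar>) = s}))"
  have "1 - fps_X\<^sup>2 = (1 - fps_X) * (1 + fps_X :: real fps)" by (simp add: algebra_simps power2_eq_square)
  then have "?F * (1 - fps_X\<^sup>2) ^ card I = ?F * (1 - fps_X) ^ card I * (1 + fps_X) ^ card I"
    by (simp only: power_mult_distrib mult.assoc)
  also have "\<dots> = (1 + fps_X) ^ (2 * card I)"
    unfolding fps_count_PiE_int[OF assms] by (simp add: mult_2 power_add)
  finally show ?thesis
    using even_part_mult[of ?F "card I"] by (simp add: one_plus_X_power_nth)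
qed

section \<open>The root lattices\<close>

no_notation fps_nth (infixl "$" 75)

section \<open>The 1-norm, integral vectors and the generators\<close>

definition l1 :: "real ^ 'n \<Rightarrow> real" where
  "l1 x = (\<Sum>i\<in>UNIV. \<bar>x $ i\<bar>)"

lemma l1_scale: "t \<ge> 0 \<Longrightarrow> l1 (t *\<^sub>R x) = t * l1 x"
  by (simp add: l1_def abs_mult sum_distrib_left)

lemma l1_triangle: "l1 (x + y) \<le> l1 x + l1 y"
  unfolding l1_def sum.distrib[symmetric] by (intro sum_mono) (simp add: abs_triangle_ineq)

lemma l1_eq_0: "l1 x = 0 \<longleftrightarrow> x = 0"
  by (simp add: l1_def sum_nonneg_eq_0_iff vec_eq_iff)

text \<open>Covers all descent steps: \<open>i = j\<close> with \<open>s = 0\<close> for a generator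
  2 e_i, and negative \<open>s\<close> when type D has to enlarge a zero coordinate.\<close>

lemma l1_change:
  fixes x y :: "real ^ 'n"
  assumes "\<And>k. \<bar>y $ k\<bar> = \<bar>x $ k\<bar> - (if k = i then r else 0) - (if k = j then s else 0)"
  shows "l1 y = l1 x - r - s"
  by (simp add: l1_def assms sum_subtractf)

definition of_int_vec :: "('n::finite \<Rightarrow> int) \<Rightarrow> real ^ 'n" where
  "of_int_vec z = (\<chi> i. of_int (z i))"

lemma of_int_vec_nth [simp]: "of_int_vec z $ i = of_int (z i)"
  by (simp add: of_int_vec_def)

lemma inj_of_int_vec: "inj of_int_vec"
  by (rule injI) (simp add: vec_eq_iff fun_eq_iff)

lemma integral_vec:
  assumes "\<And>i. x $ i \<in> \<int>"
  obtains z where "x = of_int_vec z"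
proof -
  have "\<forall>i. \<exists>k. x $ i = of_int k" using assms by (auto elim!: Ints_cases)
  then obtain z where "\<And>i. x $ i = of_int (z i)" by metis
  then show ?thesis using that[of z] by (simp add: vec_eq_iff)
qed

lemma l1_of_int_vec: "l1 (of_int_vec z) = real (\<Sum>i\<in>UNIV. nat \<bar>z i\<bar>)"
  by (simp add: l1_def)

lemma even_sum_nat_abs: "even (\<Sum>i\<in>A. nat \<bar>z i\<bar>) \<longleftrightarrow> even (\<Sum>i\<in>A. z i :: int)"
proof (cases "finite A")
  case True
  then show ?thesis by (induction A) (auto simp: even_nat_iff)
qed simp

lemma sum_of_int_vec: "(\<Sum>i\<in>UNIV. of_int_vec z $ i) = of_int (\<Sum>i\<in>UNIV. z i)"
  by simp

lemma A_lattice_eq: "A_lattice = of_int_vec ` {z. (\<Sum>i\<in>UNIV. z i) = 0}"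
proof (intro equalityI subsetI)
  fix x :: "real ^ 'n" assume x: "x \<in> A_lattice"
  then obtain z where z: "x = of_int_vec z" using integral_vec[of x] by (auto simp: A_lattice_def)
  then have "real_of_int (\<Sum>i\<in>UNIV. z i) = 0" using x by (simp add: A_lattice_def)
  then have "(\<Sum>i\<in>UNIV. z i) = 0" by (simp only: of_int_eq_0_iff)
  then show "x \<in> of_int_vec ` {z. (\<Sum>i\<in>UNIV. z i) = 0}" using z by blast
next
  fix x :: "real ^ 'n" assume "x \<in> of_int_vec ` {z. (\<Sum>i\<in>UNIV. z i) = 0}"
  then show "x \<in> A_lattice" by (auto simp: A_lattice_def simp flip: of_int_sum)
qed

lemma D_lattice_eq: "D_lattice = of_int_vec ` {z. even (\<Sum>i\<in>UNIV. z i)}"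
proof (intro equalityI subsetI)
  fix x :: "real ^ 'n" assume x: "x \<in> D_lattice"
  then obtain z where z: "x = of_int_vec z" using integral_vec[of x] by (auto simp: D_lattice_def)
  then obtain m :: int where "real_of_int (\<Sum>i\<in>UNIV. z i) = of_int (2 * m)"
    using x by (auto simp: D_lattice_def)
  then have "(\<Sum>i\<in>UNIV. z i) = 2 * m" by (simp only: of_int_eq_iff)
  then show "x \<in> of_int_vec ` {z. even (\<Sum>i\<in>UNIV. z i)}" using z by auto
next
  fix x :: "real ^ 'n" assume "x \<in> of_int_vec ` {z. even (\<Sum>i\<in>UNIV. z i)}"
  then obtain z m where z: "x = of_int_vec z" "(\<Sum>i\<in>UNIV. z i) = 2 * m" by auto
  have "(\<Sum>i\<in>UNIV. x $ i) = 2 * of_int m" unfolding z(1) sum_of_int_vec z(2) by simp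
  then show "x \<in> D_lattice" using z(1) by (auto simp: D_lattice_def)
qed

lemma A_lattice_diff: "u \<in> A_lattice \<Longrightarrow> v \<in> A_lattice \<Longrightarrow> u - v \<in> A_lattice"
  by (auto simp: A_lattice_def sum_subtractf)

lemma D_lattice_diff:
  assumes "u \<in> D_lattice" "v \<in> D_lattice"
  shows "u - v \<in> D_lattice"
proof -
  obtain m k :: int where "(\<Sum>i\<in>UNIV. u $ i) = 2 * of_int m" "(\<Sum>i\<in>UNIV. v $ i) = 2 * of_int k"
    using assms by (auto simp: D_lattice_def)
  then have "(\<Sum>i\<in>UNIV. (u - v) $ i) = 2 * of_int (m - k)" by (simp add: sum_subtractf)
  then have "\<exists>m::int. (\<Sum>i\<in>UNIV. (u - v) $ i) = 2 * of_int m" by blast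
  then show ?thesis using assms unfolding D_lattice_def by simp
qed

lemma sum_axis: "(\<Sum>k\<in>UNIV. axis i (c::real) $ k) = c"
  by (simp add: axis_def)

lemma l1_half_Nats:
  assumes "u \<in> D_lattice"
  shows "l1 u / 2 \<in> \<nat>"
proof -
  obtain z where z: "u = of_int_vec z" "even (\<Sum>i\<in>UNIV. z i)" using assms by (auto simp: D_lattice_eq)
  then obtain m where "(\<Sum>i\<in>UNIV. nat \<bar>z i\<bar>) = 2 * m" using even_sum_nat_abs[of z UNIV] by auto
  then have "l1 u / 2 = real m" unfolding z(1) l1_of_int_vec by simp
  then show ?thesis by simp
qed

lemma A_lattice_subset_D: "A_lattice \<subseteq> D_lattice"
  by (auto simp: A_lattice_eq D_lattice_eq)

lemma C_generators_alt:
  "C_generators = {s *\<^sub>R axis i 2 | s i. s \<in> {1, -1}} \<union> D_generators"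
  by (simp only: C_generators_def D_generators_def)

lemma A_generatorsI: "i \<noteq> j \<Longrightarrow> axis i 1 - axis j 1 \<in> A_generators"
  unfolding A_generators_def by (rule CollectI, rule exI[of _ i], rule exI[of _ j], rule conjI, rule refl)

lemma D_generatorsI:
  "s \<in> {1, -1} \<Longrightarrow> t \<in> {1, -1} \<Longrightarrow> i \<noteq> j \<Longrightarrow> s *\<^sub>R axis i 1 + t *\<^sub>R axis j 1 \<in> D_generators"
  unfolding D_generators_def
  by (rule CollectI, rule exI[of _ s], rule exI[of _ t], rule exI[of _ i], rule exI[of _ j])
    (intro conjI; (rule refl | assumption))

lemma D_subset_C_generators: "D_generators \<subseteq> C_generators"
  by (simp add: C_generators_alt)

lemma C_generatorsI: "s \<in> {1, -1} \<Longrightarrow> s *\<^sub>R axis i 2 \<in> C_generators"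
  unfolding C_generators_alt by (rule UnI1, rule CollectI, rule exI[of _ s], rule exI[of _ i], rule conjI, rule refl)

lemma finite_generators:
  "finite (A_generators :: (real ^ 'n) set)" "finite (C_generators :: (real ^ 'n) set)"
  "finite (D_generators :: (real ^ 'n) set)"
proof -
  have "A_generators \<subseteq> (\<Union>i. \<Union>j :: 'n. {axis i (1::real) - axis j 1})"
    unfolding A_generators_def by blast
  then show "finite (A_generators :: (real ^ 'n) set)" by (rule finite_subset) simp
  have "D_generators \<subseteq> (\<Union>s\<in>{1, -1}. \<Union>t\<in>{1, -1}. \<Union>i. \<Union>j :: 'n. {s *\<^sub>R axis i (1::real) + t *\<^sub>R axis j 1})"
    unfolding D_generators_def by blast
  then show D: "finite (D_generators :: (real ^ 'n) set)" by (rule finite_subset) simp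
  have "{s *\<^sub>R axis i 2 | s i. s \<in> {1, -1}} \<subseteq> (\<Union>s\<in>{1, -1}. \<Union>i :: 'n. {s *\<^sub>R axis i (2::real)})"
    by blast
  then have "finite {s *\<^sub>R axis (i :: 'n) (2::real) | s i. s \<in> {1, -1}}" by (rule finite_subset) simp
  then show "finite (C_generators :: (real ^ 'n) set)" unfolding C_generators_alt using D by simp
qed

lemma uminus_image_eq:
  fixes M :: "'a::group_add set"
  assumes "\<And>a. a \<in> M \<Longrightarrow> - a \<in> M"
  shows "uminus ` M = M"
proof (intro equalityI subsetI)
  show "a \<in> uminus ` M" if "a \<in> M" for a
    using assms[OF that] by (intro image_eqI[of _ _ "- a"]) auto
qed (use assms in auto)

lemma generators_symmetric:
  "uminus ` (A_generators :: (real ^ 'n) set) = A_generators"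
  "uminus ` (D_generators :: (real ^ 'n) set) = D_generators"
  "uminus ` (C_generators :: (real ^ 'n) set) = C_generators"
proof -
  show "uminus ` (A_generators :: (real ^ 'n) set) = A_generators"
  proof (rule uminus_image_eq)
    fix a :: "real ^ 'n" assume "a \<in> A_generators"
    then obtain i j where "a = axis i 1 - axis j 1" "i \<noteq> j" by (auto simp: A_generators_def)
    then show "- a \<in> A_generators" using A_generatorsI[of j i] by simp
  qed
  have D: "- a \<in> D_generators" if a: "a \<in> D_generators" for a :: "real ^ 'n"
  proof -
    obtain s t i j where "a = s *\<^sub>R axis i 1 + t *\<^sub>R axis j 1" "s \<in> {1, -1}" "t \<in> {1, -1}" "i \<noteq> j"
      using a unfolding D_generators_def by blast
    then show "- a \<in> D_generators" using D_generatorsI[of "- s" "- t" i j] by auto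
  qed
  then show "uminus ` (D_generators :: (real ^ 'n) set) = D_generators" by (rule uminus_image_eq)
  show "uminus ` (C_generators :: (real ^ 'n) set) = C_generators"
  proof (rule uminus_image_eq)
    fix a :: "real ^ 'n" assume "a \<in> C_generators"
    then consider "a \<in> D_generators" | s i where "a = s *\<^sub>R axis i 2" "s \<in> {1, -1}"
      unfolding C_generators_alt by auto
    then show "- a \<in> C_generators"
    proof cases
      case 1 then show ?thesis using D D_subset_C_generators by blast
    next
      case 2 then show ?thesis using C_generatorsI[of "- s" i] by auto
    qed
  qed
qed

lemma A_generators_subset: "A_generators \<subseteq> A_lattice"
  by (auto simp: A_generators_def A_lattice_def sum_subtractf sum_axis) (auto simp: axis_def)

lemma D_generators_subset: "D_generators \<subseteq> D_lattice"
proof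
  fix a :: "real ^ 'n" assume "a \<in> D_generators"
  then obtain s t i j where a: "a = s *\<^sub>R axis i 1 + t *\<^sub>R axis j 1" "s \<in> {1, -1}" "t \<in> {1, -1}"
    unfolding D_generators_def by blast
  then have "(\<Sum>k\<in>UNIV. a $ k) = s + t" by (simp add: sum.distrib sum_axis flip: sum_distrib_left)
  moreover have "\<exists>m::int. s + t = 2 * of_int m"
    using a(2,3) by (auto intro: exI[of _ 1] exI[of _ 0] exI[of _ "-1"])
  ultimately show "a \<in> D_lattice" using a by (auto simp: D_lattice_def axis_def)
qed

lemma C_generators_subset: "(C_generators :: (real ^ 'n) set) \<subseteq> C_lattice"
proof -
  have "s *\<^sub>R axis i 2 \<in> D_lattice" if "s \<in> {1, -1}" for s :: real and i :: "'n"
  proof -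
    have "(\<Sum>k\<in>UNIV. (s *\<^sub>R axis i (2::real)) $ k) = 2 * s"
      by (simp add: sum_axis flip: sum_distrib_left)
    moreover have "\<exists>m::int. 2 * s = 2 * of_int m"
      using that by (auto intro: exI[of _ 1] exI[of _ "-1"])
    ultimately show ?thesis using that by (auto simp: D_lattice_def axis_def)
  qed
  then show ?thesis
    unfolding C_generators_alt C_lattice_def using D_generators_subset by auto
qed

section \<open>Descent for types A and C\<close>

lemma l1_generator:
  fixes s t :: real and i j :: "'n::finite"
  assumes "i \<noteq> j" "\<bar>s\<bar> = 1" "\<bar>t\<bar> = 1"
  shows "l1 (s *\<^sub>R axis i (1::real) + t *\<^sub>R axis j 1) = 2"
proof -
  have "\<bar>(s *\<^sub>R axis i (1::real) + t *\<^sub>R axis j 1) $ k\<bar> = (if k = i then 1 else 0) + (if k = j then 1 else 0)" for k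
    using assms by (auto simp: axis_def)
  then show ?thesis by (simp add: l1_def sum.distrib)
qed

lemma l1_A_generators: "a \<in> A_generators \<Longrightarrow> l1 a = 2"
  using l1_generator[of _ _ 1 "-1"] by (auto simp: A_generators_def)

lemma l1_C_generators:
  assumes "(a :: real ^ 'n) \<in> C_generators"
  shows "l1 a = 2"
proof -
  have "l1 (s *\<^sub>R axis i (2::real)) = 2" if "s \<in> {1, -1}" for s :: real and i :: 'n
  proof -
    have "\<bar>(s *\<^sub>R axis i (2::real)) $ k\<bar> = (if k = i then 2 else 0)" for k using that by (auto simp: axis_def)
    then show ?thesis by (simp add: l1_def)
  qed
  moreover have "l1 a = 2" if "a \<in> D_generators"
  proof -
    obtain s t i j where a: "a = s *\<^sub>R axis i 1 + t *\<^sub>R axis j 1" "s \<in> {1, -1}" "t \<in> {1, -1}" "i \<noteq> j"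
      using \<open>a \<in> D_generators\<close> unfolding D_generators_def by blast
    then have "\<bar>s\<bar> = 1" "\<bar>t\<bar> = 1" by auto
    then show ?thesis unfolding a(1) using l1_generator a(4) by blast
  qed
  ultimately show ?thesis using assms unfolding C_generators_alt by auto
qed

text \<open>A nonzero integral vector of sum 0 has a positive entry i and a negative entry j;
  subtracting e_i - e_j lowers both absolute values by 1.\<close>

lemma A_lattice_norm:
  assumes "CARD('n::finite) \<ge> 2"
  shows "lattice_norm (A_lattice :: (real ^ 'n) set) A_generators (\<lambda>u. l1 u / 2)"
proof
  show "(A_generators :: (real ^ 'n) set) \<noteq> {}"
  proof -
    obtain i j :: 'n where "i \<noteq> j"
      using assms by (metis card_2_iff' obtain_subset_with_card_n)
    then show ?thesis using A_generatorsI by blast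
  qed
  fix u :: "real ^ 'n" assume u: "u \<in> A_lattice"
  show "l1 u / 2 \<in> \<nat>" using l1_half_Nats u A_lattice_subset_D by blast
  assume "u \<noteq> 0"
  obtain z where z: "u = of_int_vec z" "(\<Sum>i\<in>UNIV. z i) = 0" using u by (auto simp: A_lattice_eq)
  have nz: "\<exists>i. z i \<noteq> 0" using \<open>u \<noteq> 0\<close> z(1) by (auto simp: vec_eq_iff)
  have "\<exists>i. z i > 0"
  proof (rule ccontr)
    assume "\<not> ?thesis"
    then have "\<And>i. z i \<le> 0" by (simp add: not_less)
    then show False using z(2) nz sum_nonneg_eq_0_iff[of UNIV "\<lambda>i. - z i"] by (auto simp: sum_negf)
  qed
  moreover have "\<exists>j. z j < 0"
  proof (rule ccontr)
    assume "\<not> ?thesis"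
    then have "\<And>i. z i \<ge> 0" by (simp add: not_less)
    then show False using z(2) nz sum_nonneg_eq_0_iff[of UNIV z] by auto
  qed
  ultimately obtain i j where ij: "z i > 0" "z j < 0" by blast
  then have "i \<noteq> j" by auto
  have "\<bar>(u - (axis i 1 - axis j 1)) $ k\<bar> = \<bar>u $ k\<bar> - (if k = i then 1 else 0) - (if k = j then 1 else 0)" for k
    using ij \<open>i \<noteq> j\<close> by (auto simp: z(1) axis_def)
  then have "l1 (u - (axis i 1 - axis j 1)) = l1 u - 1 - 1" by (rule l1_change)
  then show "\<exists>a\<in>A_generators. l1 (u - a) / 2 \<le> l1 u / 2 - 1"
    using A_generatorsI[OF \<open>i \<noteq> j\<close>] by (intro bexI[of _ "axis i 1 - axis j 1"]) auto
next
  show "u - a \<in> A_lattice" if "u \<in> A_lattice" "a \<in> A_generators" for u a :: "real ^ 'n"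
    using that A_generators_subset A_lattice_diff by blast
  show "l1 (x + y) / 2 \<le> l1 x / 2 + l1 y / 2" for x y :: "real ^ 'n"
    using l1_triangle[of x y] by linarith
qed (simp_all add: finite_generators generators_symmetric A_generators_subset l1_A_generators
    l1_scale l1_eq_0)

lemma sgn_real_of_int_mem: "z \<noteq> 0 \<Longrightarrow> sgn (real_of_int z) \<in> {1, -1}"
  by (auto simp: sgn_if)

text \<open>An entry of absolute value at least 2 is lowered by a multiple of 2 e_i. An entry of
  absolute value 1 cannot be the only nonzero one because the coordinate sum is even, so a second
  entry can be lowered with it.\<close>

lemma C_lattice_norm: "lattice_norm (C_lattice :: (real ^ 'n) set) C_generators (\<lambda>u. l1 u / 2)"
proof
  show "(C_generators :: (real ^ 'n) set) \<noteq> {}" using C_generatorsI[of 1] by auto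
  fix u :: "real ^ 'n" assume u: "u \<in> C_lattice"
  show "l1 u / 2 \<in> \<nat>" using l1_half_Nats u unfolding C_lattice_def by blast
  assume "u \<noteq> 0"
  obtain z where z: "u = of_int_vec z" "even (\<Sum>i\<in>UNIV. z i)"
    using u by (auto simp: D_lattice_eq C_lattice_def)
  obtain i where i: "z i \<noteq> 0" using \<open>u \<noteq> 0\<close> z(1) by (auto simp: vec_eq_iff)
  show "\<exists>a\<in>C_generators. l1 (u - a) / 2 \<le> l1 u / 2 - 1"
  proof (cases "\<bar>z i\<bar> \<ge> 2")
    case True
    let ?a = "sgn (real_of_int (z i)) *\<^sub>R axis i (2::real)"
    have "\<bar>(u - ?a) $ k\<bar> = \<bar>u $ k\<bar> - (if k = i then 2 else 0) - (if k = i then 0 else 0)" for k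
      using True by (auto simp: z(1) axis_def sgn_if)
    then have "l1 (u - ?a) = l1 u - 2 - 0" by (rule l1_change)
    moreover have "?a \<in> C_generators" using sgn_real_of_int_mem[OF i] by (rule C_generatorsI)
    ultimately show ?thesis by (intro bexI[of _ ?a]) auto
  next
    case False
    then have zi: "\<bar>z i\<bar> = 1" using i by linarith
    have "\<exists>j. j \<noteq> i \<and> z j \<noteq> 0"
    proof (rule ccontr)
      assume "\<not> ?thesis"
      then have "(\<Sum>k\<in>UNIV - {i}. z k) = 0" by (intro sum.neutral) auto
      then have "(\<Sum>k\<in>UNIV. z k) = z i" by (simp add: sum.remove[of UNIV i z])
      then have "even (z i)" using z(2) by simp
      then show False using zi by presburger
    qed
    then obtain j where j: "j \<noteq> i" "z j \<noteq> 0" by blast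
    let ?a = "sgn (real_of_int (z i)) *\<^sub>R axis i 1 + sgn (real_of_int (z j)) *\<^sub>R axis j 1"
    have "\<bar>(u - ?a) $ k\<bar> = \<bar>u $ k\<bar> - (if k = i then 1 else 0) - (if k = j then 1 else 0)" for k
      using i j by (auto simp: z(1) axis_def sgn_if)
    then have "l1 (u - ?a) = l1 u - 1 - 1" by (rule l1_change)
    moreover have "?a \<in> C_generators"
      by (intro subsetD[OF D_subset_C_generators] D_generatorsI sgn_real_of_int_mem i j(2) j(1)[symmetric])
    ultimately show ?thesis by (intro bexI[of _ ?a]) auto
  qed
next
  show "u - a \<in> C_lattice" if "u \<in> C_lattice" "a \<in> C_generators" for u a :: "real ^ 'n"
    using that C_generators_subset D_lattice_diff unfolding C_lattice_def by blast
  show "l1 (x + y) / 2 \<le> l1 x / 2 + l1 y / 2" for x y :: "real ^ 'n"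
    using l1_triangle[of x y] by linarith
qed (simp_all add: finite_generators generators_symmetric C_generators_subset l1_C_generators
    l1_scale l1_eq_0)

section \<open>The norm and descent for type D\<close>

lemma infnorm_le_iff: "infnorm (x :: real ^ 'n) \<le> r \<longleftrightarrow> (\<forall>i. \<bar>x $ i\<bar> \<le> r)"
proof -
  have "finite (range (\<lambda>i. \<bar>x $ i\<bar>))" by simp
  moreover have "infnorm x = Sup (range (\<lambda>i. \<bar>x $ i\<bar>))"
    by (simp add: infnorm_cart full_SetCompr_eq)
  ultimately show ?thesis by (subst (asm) cSup_eq_Max) auto
qed

lemma infnorm_attained: "\<exists>i. infnorm (x :: real ^ 'n) = \<bar>x $ i\<bar>"
proof -
  have "finite (range (\<lambda>i. \<bar>x $ i\<bar>))" by simp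
  moreover have "infnorm x = Sup (range (\<lambda>i. \<bar>x $ i\<bar>))"
    by (simp add: infnorm_cart full_SetCompr_eq)
  ultimately have "infnorm x \<in> range (\<lambda>i. \<bar>x $ i\<bar>)"
    using Max_in[of "range (\<lambda>i. \<bar>x $ i\<bar>)"] by (simp add: cSup_eq_Max)
  then show ?thesis by blast
qed

text \<open>Each generator of type D changes any coordinate by at most 1 and the 1-norm by at most
  2, so both terms are lower bounds for the word length. The first dominates for vectors such as 2
  e_i.\<close>

definition D_norm :: "real ^ 'n \<Rightarrow> real" where
  "D_norm x = max (infnorm x) (l1 x / 2)"

lemma D_norm_le_iff: "D_norm x \<le> r \<longleftrightarrow> (\<forall>i. \<bar>x $ i\<bar> \<le> r) \<and> l1 x / 2 \<le> r"
  by (simp add: D_norm_def infnorm_le_iff)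

lemma D_norm_D_generators:
  assumes "(a :: real ^ 'n) \<in> D_generators"
  shows "D_norm a = 1"
proof -
  have "\<bar>a $ k\<bar> \<le> 1" for k using assms by (auto simp: D_generators_def axis_def)
  then have "infnorm a \<le> 1" by (simp add: infnorm_le_iff)
  moreover have "l1 a = 2" using l1_C_generators assms D_subset_C_generators by blast
  ultimately show ?thesis by (simp add: D_norm_def)
qed

lemma l1_ge_three:
  assumes "i \<noteq> j" "i \<noteq> k" "j \<noteq> k"
  shows "\<bar>(x :: real ^ 'n) $ i\<bar> + \<bar>x $ j\<bar> + \<bar>x $ k\<bar> \<le> l1 x"
proof -
  have "(\<Sum>l\<in>{i, j, k}. \<bar>x $ l\<bar>) \<le> l1 x"
    unfolding l1_def by (rule sum_mono2) auto
  then show ?thesis using assms by simp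
qed

lemma D_lattice_norm:
  assumes "CARD('n::finite) \<ge> 2"
  shows "lattice_norm (D_lattice :: (real ^ 'n) set) D_generators D_norm"
proof
  have two: "\<exists>j. j \<noteq> i" for i :: 'n
  proof (rule ccontr)
    assume "\<not> ?thesis"
    then have "(UNIV :: 'n set) \<subseteq> {i}" by auto
    then have "CARD('n) \<le> 1" using card_mono[of "{i}" UNIV] by simp
    then show False using assms by simp
  qed
  show "(D_generators :: (real ^ 'n) set) \<noteq> {}"
    using two[of undefined] D_generatorsI[of 1 1] by blast
  show "D_norm (t *\<^sub>R x) = t * D_norm x" if "t \<ge> 0" for t and x :: "real ^ 'n"
    using that by (simp add: D_norm_def infnorm_mul l1_scale max_mult_distrib_left)
  show "D_norm (x + y) \<le> D_norm x + D_norm y" for x y :: "real ^ 'n"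
    using infnorm_triangle[of x y] l1_triangle[of x y] unfolding D_norm_def by linarith
  show "x = 0" if "D_norm x = 0" for x :: "real ^ 'n"
  proof -
    have "infnorm x \<le> 0" using that by (simp add: D_norm_def max_def split: if_splits)
    then show ?thesis using infnorm_pos_le[of x] infnorm_eq_0[of x] by simp
  qed
  fix u :: "real ^ 'n" assume u: "u \<in> D_lattice"
  obtain z where z: "u = of_int_vec z" "even (\<Sum>i\<in>UNIV. z i)"
    using u by (auto simp: D_lattice_eq)
  obtain i where i: "infnorm u = \<bar>u $ i\<bar>" using infnorm_attained by blast
  have "\<bar>u $ i\<bar> = real (nat \<bar>z i\<bar>)" by (simp add: z(1))
  then have infN: "infnorm u \<in> \<nat>" using i by (metis of_nat_in_Nats)
  show N: "D_norm u \<in> \<nat>"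
    unfolding D_norm_def using infN l1_half_Nats[OF u] by (simp add: max_def)
  assume "u \<noteq> 0"
  have le_i: "\<bar>z k\<bar> \<le> \<bar>z i\<bar>" for k
  proof -
    have "\<bar>u $ k\<bar> \<le> \<bar>u $ i\<bar>" using infnorm_le_iff[of u "\<bar>u $ i\<bar>"] i by simp
    then show ?thesis by (simp add: z(1))
  qed
  have zi: "z i \<noteq> 0"
  proof
    assume "z i = 0"
    then have "\<And>k. z k = 0" using le_i by fastforce
    then show False using \<open>u \<noteq> 0\<close> by (simp add: z(1) vec_eq_iff)
  qed
  \<comment> \<open>The descent step has to lower the largest entry; the partner \<open>j\<close> is
    the largest among the others.\<close>
  obtain j where j: "j \<noteq> i" "\<And>k. k \<noteq> i \<Longrightarrow> \<bar>z k\<bar> \<le> \<bar>z j\<bar>"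
  proof -
    have "UNIV - {i} \<noteq> {}" using two[of i] by auto
    then have "Max ((\<lambda>k. \<bar>z k\<bar>) ` (UNIV - {i})) \<in> (\<lambda>k. \<bar>z k\<bar>) ` (UNIV - {i})"
      by (intro Max_in) auto
    then obtain j where j: "j \<noteq> i" "Max ((\<lambda>k. \<bar>z k\<bar>) ` (UNIV - {i})) = \<bar>z j\<bar>" by auto
    have "\<bar>z k\<bar> \<le> \<bar>z j\<bar>" if "k \<noteq> i" for k
      unfolding j(2)[symmetric] using that by (intro Max_ge) auto
    then show ?thesis using \<open>j \<noteq> i\<close> that by blast
  qed
  have two_i: "\<bar>z i\<bar> \<le> D_norm u" using i by (simp add: D_norm_def z(1))
  have half: "l1 u / 2 \<le> D_norm u" by (simp add: D_norm_def)
  show "\<exists>a\<in>D_generators. D_norm (u - a) \<le> D_norm u - 1"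
  proof (cases "z j = 0")
    case False
    let ?a = "sgn (real_of_int (z i)) *\<^sub>R axis i 1 + sgn (real_of_int (z j)) *\<^sub>R axis j 1"
    have ch: "\<bar>(u - ?a) $ k\<bar> = \<bar>u $ k\<bar> - (if k = i then 1 else 0) - (if k = j then 1 else 0)" for k
      using zi j(1) False by (auto simp: z(1) axis_def sgn_if)
    have "l1 (u - ?a) = l1 u - 1 - 1" using ch by (rule l1_change)
    moreover have "\<bar>(u - ?a) $ k\<bar> \<le> D_norm u - 1" for k
    proof (cases "k = i \<or> k = j")
      case True
      then show ?thesis using ch[of k] j(1) two_i le_i[of j] by (auto simp: z(1))
    next
      case k: False
      have "\<bar>u $ i\<bar> + \<bar>u $ j\<bar> + \<bar>u $ k\<bar> \<le> l1 u" using l1_ge_three[of i j k] k j(1) by auto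
      moreover obtain m where m: "l1 u / 2 = real m" using l1_half_Nats[OF u] by (auto elim!: Nats_cases)
      ultimately have "real_of_int (\<bar>z i\<bar> + \<bar>z j\<bar> + \<bar>z k\<bar>) \<le> of_int (2 * int m)"
        by (simp add: z(1))
      then have "\<bar>z i\<bar> + \<bar>z j\<bar> + \<bar>z k\<bar> \<le> 2 * int m" by (simp only: of_int_le_iff)
      \<comment> \<open>An untouched entry must already be at most m - 1. Being the smallest of
        three entries of total at most 2m, it is at most 2m/3, and m is positive because
        \<open>z i\<close> and \<open>z j\<close> are nonzero.\<close>
      then have "\<bar>z k\<bar> \<le> int m - 1" using j(2)[of k] le_i[of k] le_i[of j] k zi False by linarith
      then have "real_of_int \<bar>z k\<bar> \<le> of_int (int m - 1)" by (simp only: of_int_le_iff)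
      then show ?thesis using ch[of k] k half m by (simp add: z(1))
    qed
    ultimately have "D_norm (u - ?a) \<le> D_norm u - 1"
      unfolding D_norm_le_iff using half by simp
    moreover have "?a \<in> D_generators"
      by (intro D_generatorsI sgn_real_of_int_mem zi False j(1)[symmetric])
    ultimately show ?thesis by (intro bexI[of _ ?a])
  next
    case True
    have z0: "z k = 0" if "k \<noteq> i" for k using j(2)[OF that] True by simp
    then have "(\<Sum>k\<in>UNIV - {i}. z k) = 0" by (intro sum.neutral) auto
    then have "(\<Sum>k\<in>UNIV. z k) = z i" by (simp add: sum.remove[of UNIV i z])
    then have "even (z i)" using z(2) by simp
    then have "\<bar>z i\<bar> \<ge> 2" using zi by presburger
    then have ge2: "real_of_int \<bar>z i\<bar> \<ge> 2" by linarith
    \<comment> \<open>With a single nonzero entry, a zero coordinate has to be raised to 1. The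
      1-norm then stays put, but it is only |z i|, and half of that is at most |z i| - 1 since |z i|
      is at least 2.\<close>
    let ?a = "sgn (real_of_int (z i)) *\<^sub>R axis i 1 + 1 *\<^sub>R axis j 1"
    have ch: "\<bar>(u - ?a) $ k\<bar> = \<bar>u $ k\<bar> - (if k = i then 1 else 0) - (if k = j then -1 else 0)" for k
      using zi j(1) z0[OF j(1)] by (auto simp: z(1) axis_def sgn_if)
    have "l1 (u - ?a) = l1 u - 1 - (-1)" using ch by (rule l1_change)
    moreover have "l1 u = real_of_int \<bar>z i\<bar>"
    proof -
      have "(\<Sum>k\<in>UNIV - {i}. \<bar>u $ k\<bar>) = 0" using z0 by (intro sum.neutral) (auto simp: z(1))
      moreover have "l1 u = \<bar>u $ i\<bar> + (\<Sum>k\<in>UNIV - {i}. \<bar>u $ k\<bar>)"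
        unfolding l1_def by (rule sum.remove) auto
      ultimately show ?thesis by (simp add: z(1))
    qed
    moreover have "\<bar>(u - ?a) $ k\<bar> \<le> D_norm u - 1" for k
    proof (cases "k = i")
      case True
      then show ?thesis using ch[of i] j(1) two_i by (simp add: z(1))
    next
      case False
      then have "\<bar>(u - ?a) $ k\<bar> \<le> 1" using ch[of k] z0[of k] by (simp add: z(1))
      then show ?thesis using two_i ge2 by linarith
    qed
    ultimately have "D_norm (u - ?a) \<le> D_norm u - 1"
      unfolding D_norm_le_iff using two_i ge2 by auto
    moreover have "?a \<in> D_generators"
      by (intro D_generatorsI sgn_real_of_int_mem zi j(1)[symmetric]) simp
    ultimately show ?thesis by (intro bexI[of _ ?a])
  qed
next
  show "u - a \<in> D_lattice" if "u \<in> D_lattice" "a \<in> D_generators" for u a :: "real ^ 'n"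
    using that D_generators_subset D_lattice_diff by blast
qed (simp_all add: finite_generators generators_symmetric D_generators_subset D_norm_D_generators)

section \<open>Ranks of the lattices\<close>

lemma dim_A_lattice: "dim (A_lattice :: (real ^ 'n) set) = CARD('n::finite) - 1"
proof -
  let ?H = "{x :: real ^ 'n. (\<chi> i. 1) \<bullet> x = 0}"
  have H: "?H = {x. (\<Sum>i\<in>UNIV. x $ i) = 0}" by (simp add: inner_vec_def)
  have "?H \<subseteq> span A_lattice"
  proof
    fix x :: "real ^ 'n" assume "x \<in> ?H"
    then have x0: "(\<Sum>i\<in>UNIV. x $ i) = 0" using H by auto
    define j :: 'n where "j = undefined"
    have mem: "axis i 1 - axis j 1 \<in> A_lattice" for i
      by (auto simp: A_lattice_def sum_subtractf sum_axis) (auto simp: axis_def)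
    have "x = (\<Sum>i\<in>UNIV. (x $ i) *\<^sub>R axis i 1)"
      using basis_expansion[of x] by (simp add: scalar_mult_eq_scaleR)
    also have "\<dots> = (\<Sum>i\<in>UNIV. (x $ i) *\<^sub>R (axis i 1 - axis j 1))"
      using x0 by (simp add: scaleR_diff_right sum_subtractf flip: scaleR_left.sum)
    also have "\<dots> \<in> span A_lattice" by (intro span_sum span_scale span_base mem)
    finally show "x \<in> span A_lattice" .
  qed
  then have "dim ?H \<le> dim (A_lattice :: (real ^ 'n) set)" by (rule dim_mono)
  moreover have "dim (A_lattice :: (real ^ 'n) set) \<le> dim ?H"
    unfolding H by (intro dim_subset) (auto simp: A_lattice_def)
  moreover have "dim ?H = DIM(real ^ 'n) - 1"
    by (rule dim_hyperplane) (simp add: vec_eq_iff)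
  ultimately show ?thesis by simp
qed

lemma dim_D_lattice: "dim (D_lattice :: (real ^ 'n) set) = CARD('n::finite)"
proof -
  have "(UNIV :: (real ^ 'n) set) \<subseteq> span D_lattice"
  proof
    fix x :: "real ^ 'n"
    have mem: "axis i 2 \<in> (D_lattice :: (real ^ 'n) set)" for i
      using C_generatorsI[of 1 i] C_generators_subset by (auto simp: C_lattice_def)
    have "x = (\<Sum>i\<in>UNIV. (x $ i) *\<^sub>R axis i 1)"
      using basis_expansion[of x] by (simp add: scalar_mult_eq_scaleR)
    also have "\<dots> = (\<Sum>i\<in>UNIV. (x $ i / 2) *\<^sub>R axis i 2)"
      by (rule sum.cong) (auto simp: vec_eq_iff axis_def)
    also have "\<dots> \<in> span D_lattice" by (intro span_sum span_scale span_base mem)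
    finally show "x \<in> span D_lattice" .
  qed
  then have "dim (UNIV :: (real ^ 'n) set) \<le> dim (D_lattice :: (real ^ 'n) set)" by (rule dim_mono)
  then show ?thesis using dim_subset_UNIV[of "D_lattice :: (real ^ 'n) set"] by simp
qed

section \<open>Lattice points on spheres\<close>

lemma finite_sphere: "finite {z :: 'n::finite \<Rightarrow> int. (\<Sum>i\<in>UNIV. nat \<bar>z i\<bar>) = s}"
  using finite_count_PiE_int[of "UNIV :: 'n set" s] by simp

text \<open>A pair (y, w) corresponds to its pointwise minimum m and its difference z. It is
  recovered by adding the positive and the negative part of z to m; these have disjoint supports, so
  the minimum is m again. Because z has sum 0, both parts have the same sum k - j, whence the 1-norm
  2 (k - j).\<close>

lemma bij_betw_difference_min:
  "bij_betw (\<lambda>(j, m, z). (\<lambda>i. m i + nat (z i), \<lambda>i. m i + nat (- z i)))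
     (SIGMA j:{0..k}. {m :: 'm::finite \<Rightarrow> nat. (\<Sum>i\<in>UNIV. m i) = j} \<times>
        {z :: 'm \<Rightarrow> int. (\<Sum>i\<in>UNIV. z i) = 0 \<and> (\<Sum>i\<in>UNIV. nat \<bar>z i\<bar>) = 2 * (k - j)})
     ({y. (\<Sum>i\<in>UNIV. y i) = k} \<times> {w. (\<Sum>i\<in>UNIV. w i) = k})"
  (is "bij_betw ?f ?X ?Y")
proof (rule bij_betw_byWitness)
  let ?g = "\<lambda>(y :: 'm \<Rightarrow> nat, w). (\<Sum>i\<in>UNIV. min (y i) (w i), \<lambda>i. min (y i) (w i), \<lambda>i. int (y i) - int (w i))"
  have nat_parts: "(\<Sum>i\<in>UNIV. nat (z i)) = r \<and> (\<Sum>i\<in>UNIV. nat (- z i)) = r"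
    if "(\<Sum>i\<in>UNIV. z i) = 0" "(\<Sum>i\<in>UNIV. nat \<bar>z i\<bar>) = 2 * r" for z :: "'m \<Rightarrow> int" and r
  proof -
    have "(\<Sum>i\<in>UNIV. nat \<bar>z i\<bar>) = (\<Sum>i\<in>UNIV. nat (z i)) + (\<Sum>i\<in>UNIV. nat (- z i))"
      unfolding sum.distrib[symmetric] by (rule sum.cong) auto
    moreover have "(\<Sum>i\<in>UNIV. z i) = (\<Sum>i\<in>UNIV. int (nat (z i)) - int (nat (- z i)))"
      by (rule sum.cong) auto
    then have "int (\<Sum>i\<in>UNIV. nat (z i)) = int (\<Sum>i\<in>UNIV. nat (- z i))"
      using that(1) unfolding sum_subtractf by (simp only: of_nat_sum)
    ultimately show ?thesis using that(2) by (simp only: of_nat_eq_iff) linarith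
  qed
  show "\<forall>p\<in>?X. ?g (?f p) = p"
  proof
    fix p assume "p \<in> ?X"
    then obtain j m z where p: "p = (j, m, z)" "(\<Sum>i\<in>UNIV. m i) = j" by auto
    have 1: "min (m i + nat (z i)) (m i + nat (- z i)) = m i" for i by auto
    have 2: "int (m i + nat (z i)) - int (m i + nat (- z i)) = z i" for i by auto
    show "?g (?f p) = p" unfolding p(1) prod.case 1 2 p(2) ..
  qed
  show "\<forall>p\<in>?Y. ?f (?g p) = p"
    by (auto simp: fun_eq_iff)
  show "?f ` ?X \<subseteq> ?Y"
  proof
    fix q assume "q \<in> ?f ` ?X"
    then obtain j m z where q: "q = (\<lambda>i. m i + nat (z i), \<lambda>i. m i + nat (- z i))" "j \<le> k" "(\<Sum>i\<in>UNIV. m i) = j"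
      "(\<Sum>i\<in>UNIV. z i) = 0" "(\<Sum>i\<in>UNIV. nat \<bar>z i\<bar>) = 2 * (k - j)" by auto
    then show "q \<in> ?Y" using nat_parts[OF q(4,5)] by (simp add: sum.distrib)
  qed
  show "?g ` ?Y \<subseteq> ?X"
  proof
    fix q assume "q \<in> ?g ` ?Y"
    then obtain y w where q: "q = (\<Sum>i\<in>UNIV. min (y i) (w i), \<lambda>i. min (y i) (w i), \<lambda>i. int (y i) - int (w i))"
      "(\<Sum>i\<in>UNIV. y i) = k" "(\<Sum>i\<in>UNIV. w i) = k" by auto
    have le: "(\<Sum>i\<in>UNIV. min (y i) (w i)) \<le> k" unfolding q(2)[symmetric] by (rule sum_mono) simp
    have "(\<Sum>i\<in>UNIV. int (y i) - int (w i)) = 0"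
      using q(2,3) by (simp add: sum_subtractf flip: of_nat_sum)
    moreover have "(\<Sum>i\<in>UNIV. nat \<bar>int (y i) - int (w i)\<bar>) + 2 * (\<Sum>i\<in>UNIV. min (y i) (w i)) = 2 * k"
    proof -
      have "(\<Sum>i\<in>UNIV. nat \<bar>int (y i) - int (w i)\<bar>) + 2 * (\<Sum>i\<in>UNIV. min (y i) (w i)) =
          (\<Sum>i\<in>UNIV. y i + w i)"
        unfolding sum_distrib_left sum.distrib[symmetric] by (rule sum.cong) auto
      then show ?thesis using q(2,3) by (simp add: sum.distrib)
    qed
    ultimately show "q \<in> ?X" using le q(1) by auto
  qed
qed

lemma A_count_series:
  assumes card: "CARD('m::finite) = Suc n"
  shows "Abs_fps (\<lambda>k. real (card {z :: 'm \<Rightarrow> int. (\<Sum>i\<in>UNIV. z i) = 0 \<and> (\<Sum>i\<in>UNIV. nat \<bar>z i\<bar>) = 2 * k})) *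
     (1 - fps_X) ^ n = Abs_fps (\<lambda>k. (real (n choose k))\<^sup>2)"
proof -
  define Y where "Y k = {m :: 'm \<Rightarrow> nat. (\<Sum>i\<in>UNIV. m i) = k}" for k
  define Z where "Z k = {z :: 'm \<Rightarrow> int. (\<Sum>i\<in>UNIV. z i) = 0 \<and> (\<Sum>i\<in>UNIV. nat \<bar>z i\<bar>) = 2 * k}" for k
  define A where "A = Abs_fps (\<lambda>k. real (card (Y k)))"
  define G where "G = Abs_fps (\<lambda>k. real (card (Z k)))"
  have fin: "finite (Y k)" "finite (Z k)" for k
  proof -
    show "finite (Y k)"
      using fps_count_PiE(2)[of "UNIV :: 'm set" "UNIV :: nat set" "\<lambda>b. b" k] by (simp add: Y_def)
    show "finite (Z k)" by (rule finite_subset[OF _ finite_sphere[of "2 * k"]]) (auto simp: Z_def)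
  qed
  have A: "A * (1 - fps_X) ^ Suc n = 1"
    using fps_count_PiE_nat[of "UNIV :: 'm set"] card by (simp add: A_def Y_def)
  then have "A = Abs_fps (\<lambda>k. real (n + k choose n))"
    using binomial_series[of n] fps_eq_iff_mult_one_minus_X_power by metis
  then have A_nth: "real (card (Y k)) = real (n + k choose n)" for k
    by (simp add: A_def fps_eq_iff)
  have "(card (Y k))\<^sup>2 = (\<Sum>j=0..k. card (Y j) * card (Z (k - j)))" for k
  proof -
    have "card (Y k \<times> Y k) = card (SIGMA j:{0..k}. Y j \<times> Z (k - j))"
      using bij_betw_same_card[OF bij_betw_difference_min[of k, where 'm='m]] unfolding Y_def Z_def by simp
    also have "\<dots> = (\<Sum>j=0..k. card (Y j) * card (Z (k - j)))"
      using fin by (subst card_SigmaI) (auto simp: card_cartesian_product)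
    finally show ?thesis by (simp add: card_cartesian_product power2_eq_square)
  qed
  then have "(real (card (Y k)))\<^sup>2 = fps_nth (A * G) k" for k
    by (simp add: A_def G_def fps_mult_nth flip: of_nat_power of_nat_mult of_nat_sum)
  then have AG: "Abs_fps (\<lambda>k. (real (n + k choose n))\<^sup>2) = A * G"
    by (simp add: A_nth fps_eq_iff)
  \<comment> \<open>Inserting a factor 1, written as A (1 - x)^(n+1), creates the product A G, which
    is the series of squared binomials, together with the power 2n + 1 that it requires.\<close>
  have "G * (1 - fps_X) ^ n = (A * (1 - fps_X) ^ Suc n) * G * (1 - fps_X) ^ n"
    by (simp only: A mult_1_left)
  also have "\<dots> = A * G * (1 - fps_X) ^ (2 * n + 1)"
  proof -
    have e: "2 * n + 1 = Suc n + n" by simp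
    show ?thesis unfolding e power_add by (simp only: mult_ac)
  qed
  finally have "G * (1 - fps_X) ^ n = Abs_fps (\<lambda>k. (real (n choose k))\<^sup>2)"
    unfolding AG[symmetric] binomial_square_series .
  then show ?thesis unfolding G_def Z_def .
qed

text \<open>The remaining coordinates fix the absolute value at \<open>i\<close>, so only the sign
  is free. Positivity of \<open>g\<close> makes the two signs give different vectors.\<close>

lemma card_extend_abs:
  fixes g :: "('n::finite \<Rightarrow> int) \<Rightarrow> nat" and X :: "('n \<Rightarrow> int) set"
  assumes X: "finite X" "X \<subseteq> (UNIV - {i}) \<rightarrow>\<^sub>E UNIV" and pos: "\<And>f. f \<in> X \<Longrightarrow> g f > 0"
  shows "card {z. restrict z (UNIV - {i}) \<in> X \<and> nat \<bar>z i\<bar> = g (restrict z (UNIV - {i}))} = 2 * card X"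
proof -
  let ?f = "\<lambda>(s, f). f(i := s * int (g f))"
  let ?R = "\<lambda>z :: 'n \<Rightarrow> int. restrict z (UNIV - {i})"
  have R: "?R (f(i := v)) = f" if "f \<in> X" for f v
    using that X(2) by (auto simp: fun_eq_iff restrict_def PiE_iff extensional_def)
  have "bij_betw ?f ({1, -1} \<times> X) {z. ?R z \<in> X \<and> nat \<bar>z i\<bar> = g (?R z)}"
  proof (rule bij_betw_byWitness[where f' = "\<lambda>z. (sgn (z i), ?R z)"])
    show "\<forall>p\<in>{1, -1} \<times> X. (\<lambda>z. (sgn (z i), ?R z)) (?f p) = p"
      using pos R by (auto simp: sgn_mult)
    show "\<forall>z\<in>{z. ?R z \<in> X \<and> nat \<bar>z i\<bar> = g (?R z)}. ?f (sgn (z i), ?R z) = z"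
    proof
      fix z assume z: "z \<in> {z. ?R z \<in> X \<and> nat \<bar>z i\<bar> = g (?R z)}"
      then have "int (g (?R z)) = \<bar>z i\<bar>" by auto
      then show "?f (sgn (z i), ?R z) = z" by (auto simp: fun_eq_iff sgn_if)
    qed
    show "?f ` ({1, -1} \<times> X) \<subseteq> {z. ?R z \<in> X \<and> nat \<bar>z i\<bar> = g (?R z)}"
      using R by auto
    show "(\<lambda>z. (sgn (z i), ?R z)) ` {z. ?R z \<in> X \<and> nat \<bar>z i\<bar> = g (?R z)} \<subseteq> {1, -1} \<times> X"
    proof
      fix p assume "p \<in> (\<lambda>z. (sgn (z i), ?R z)) ` {z. ?R z \<in> X \<and> nat \<bar>z i\<bar> = g (?R z)}"
      then obtain z where z: "p = (sgn (z i), ?R z)" "?R z \<in> X" "nat \<bar>z i\<bar> = g (?R z)" by auto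
      then have "z i \<noteq> 0" using pos[of "?R z"] by auto
      then show "p \<in> {1, -1} \<times> X" using z by (auto simp: sgn_if)
    qed
  qed
  then have "card {z. ?R z \<in> X \<and> nat \<bar>z i\<bar> = g (?R z)} = card ({1, -1 :: int} \<times> X)"
    by (rule bij_betw_same_card[symmetric])
  then show ?thesis by (simp add: card_cartesian_product)
qed

text \<open>Compared with type C, the type D sphere of radius \<open>k\<close> loses the vectors with an entry of absolute
  value above \<open>k\<close> and gains those with an entry \<open>\<plusminus>k\<close> that outweighs the rest. In both cases the
  dominating coordinate \<open>i\<close> is unique and determined up to sign by the other coordinates.\<close>

lemma D_count:
  fixes k :: nat
  assumes W: "\<And>i s. W s = card {f \<in> (UNIV - {i :: 'n::finite}) \<rightarrow>\<^sub>E (UNIV :: int set). (\<Sum>j\<in>UNIV - {i}. nat \<bar>f j\<bar>) = s}"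
  defines "l \<equiv> \<lambda>z :: 'n \<Rightarrow> int. \<Sum>i\<in>UNIV. nat \<bar>z i\<bar>"
  shows "card {z. even (l z) \<and> (\<forall>i. nat \<bar>z i\<bar> \<le> k) \<and> l z \<le> 2 * k \<and> (l z = 2 * k \<or> (\<exists>i. nat \<bar>z i\<bar> = k))}
      + 2 * CARD('n) * (\<Sum>s | s < k \<and> odd (s + k). W s) = card {z. l z = 2 * k}"
proof -
  let ?R = "\<lambda>i (z :: 'n \<Rightarrow> int). restrict z (UNIV - {i})"
  define r where "r i z = (\<Sum>j\<in>UNIV - {i}. nat \<bar>z j\<bar>)" for i and z :: "'n \<Rightarrow> int"
  have l_r: "l z = nat \<bar>z i\<bar> + r i z" for i z
    unfolding l_def r_def by (rule sum.remove) auto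
  have r_R: "r i (?R i z) = r i z" for i z unfolding r_def by (rule sum.cong) auto
  have le_r: "nat \<bar>z j\<bar> \<le> r i z" if "j \<noteq> i" for i j z
    unfolding r_def using that by (intro member_le_sum) auto
  define X where "X i S = {f \<in> (UNIV - {i}) \<rightarrow>\<^sub>E (UNIV :: int set). r i f \<in> S}" for i and S :: "nat set"
  have X_Un: "X i S = (\<Union>s\<in>S. {f \<in> (UNIV - {i}) \<rightarrow>\<^sub>E (UNIV :: int set). (\<Sum>j\<in>UNIV - {i}. nat \<bar>f j\<bar>) = s})" for i S
    by (auto simp: X_def r_def)
  have finX: "finite (X i S)" if "finite S" for i S
    unfolding X_Un using that by (intro finite_UN_I finite_count_PiE_int) auto
  have cardX: "card (X i S) = (\<Sum>s\<in>S. W s)" if "finite S" for i S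
    unfolding X_Un W[of _ i] using that finite_count_PiE_int[of "UNIV - {i}"]
    by (intro card_UN_disjoint) auto
  define C where "C = {z. l z = 2 * k}"
  define D where "D = {z. even (l z) \<and> (\<forall>i. nat \<bar>z i\<bar> \<le> k) \<and> l z \<le> 2 * k \<and> (l z = 2 * k \<or> (\<exists>i. nat \<bar>z i\<bar> = k))}"
  \<comment> \<open>The lost vectors: if the other coordinates have 1-norm s < k, radius 2k in the
    1-norm forces |z i| = 2k - s > k.\<close>
  define P where "P i = {z. ?R i z \<in> X i {..<k} \<and> nat \<bar>z i\<bar> = (\<lambda>f. 2 * k - r i f) (?R i z)}" for i
  \<comment> \<open>The gained vectors: |z i| = k and the rest has 1-norm s < k. Membership in the
    lattice requires k + s to be even.\<close>
  define Q where "Q i = {z. ?R i z \<in> X i {s. s < k \<and> even (s + k)} \<and> nat \<bar>z i\<bar> = (\<lambda>f. k) (?R i z)}" for i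
  have finite_even: "finite {s. s < k \<and> even (s + k)}" by (rule finite_subset[of _ "{..<k}"]) auto
  have R_X: "?R i z \<in> X i S \<longleftrightarrow> r i z \<in> S" for i S z by (simp add: X_def r_R)
  have cardP: "card (P i) = 2 * (\<Sum>s<k. W s)" for i
    unfolding P_def by (subst card_extend_abs) (auto simp: finX cardX, auto simp: X_def)
  have cardQ: "card (Q i) = 2 * (\<Sum>s | s < k \<and> even (s + k). W s)" for i
    unfolding Q_def using finite_even
    by (subst card_extend_abs) (auto simp: finX cardX, auto simp: X_def)
  have P: "P i = {z. l z = 2 * k \<and> nat \<bar>z i\<bar> > k}" for i
    unfolding P_def R_X r_R l_r[of _ i] by auto
  have Q: "Q i = {z. even (l z) \<and> l z < 2 * k \<and> nat \<bar>z i\<bar> = k}" for i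
    unfolding Q_def R_X l_r[of _ i] by auto
  have finC: "finite C" unfolding C_def l_def by (rule finite_sphere)
  have finP: "finite (P i)" for i using finC by (rule finite_subset[rotated]) (auto simp: P C_def)
  have fin_lt: "finite {z. l z < 2 * k}"
  proof -
    have "{z. l z < 2 * k} = (\<Union>s\<in>{..<2 * k}. {z. l z = s})" by auto
    then show ?thesis using finite_sphere unfolding l_def by auto
  qed
  have finQ: "finite (Q i)" for i using fin_lt by (rule finite_subset[rotated]) (auto simp: Q)
  have "card (\<Union>i. P i) = (\<Sum>i\<in>UNIV. card (P i))"
  proof (rule card_UN_disjoint)
    show "\<forall>i\<in>UNIV. \<forall>j\<in>UNIV. i \<noteq> j \<longrightarrow> P i \<inter> P j = {}"
    proof (intro ballI impI)
      fix i j :: 'n assume "i \<noteq> j"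
      have False if z: "z \<in> P i" "z \<in> P j" for z
        using z le_r[of j i z] l_r[of z i] \<open>i \<noteq> j\<close> by (simp add: P)
      then show "P i \<inter> P j = {}" by blast
    qed
  qed (use finP in auto)
  then have UP: "card (\<Union>i. P i) = CARD('n) * (2 * (\<Sum>s<k. W s))" by (simp add: cardP)
  have "card (\<Union>i. Q i) = (\<Sum>i\<in>UNIV. card (Q i))"
  proof (rule card_UN_disjoint)
    show "\<forall>i\<in>UNIV. \<forall>j\<in>UNIV. i \<noteq> j \<longrightarrow> Q i \<inter> Q j = {}"
    proof (intro ballI impI)
      fix i j :: 'n assume "i \<noteq> j"
      have False if z: "z \<in> Q i" "z \<in> Q j" for z
        using z le_r[of j i z] l_r[of z i] \<open>i \<noteq> j\<close> by (simp add: Q)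
      then show "Q i \<inter> Q j = {}" by blast
    qed
  qed (use finQ in auto)
  then have UQ: "card (\<Union>i. Q i) = CARD('n) * (2 * (\<Sum>s | s < k \<and> even (s + k). W s))" by (simp add: cardQ)
  have DQ: "D = (C - (\<Union>i. P i)) \<union> (\<Union>i. Q i)"
  proof (intro equalityI subsetI)
    fix z assume z: "z \<in> D"
    show "z \<in> (C - (\<Union>i. P i)) \<union> (\<Union>i. Q i)"
    proof (cases "l z = 2 * k")
      case True
      then show ?thesis using z by (auto simp: D_def C_def P not_less)
    next
      case False
      then show ?thesis using z by (auto simp: D_def Q)
    qed
  next
    fix z assume "z \<in> (C - (\<Union>i. P i)) \<union> (\<Union>i. Q i)"
    then consider "z \<in> C" "\<And>i. z \<notin> P i" | i where "z \<in> Q i" by blast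
    then show "z \<in> D"
    proof cases
      case 1
      then show ?thesis by (auto simp: D_def C_def P not_less)
    next
      case 2
      have "nat \<bar>z j\<bar> \<le> k" for j
        using le_r[of j i z] l_r[of z i] 2 by (cases "j = i") (auto simp: Q)
      then show ?thesis using 2 by (auto simp: D_def Q)
    qed
  qed
  have PC: "(\<Union>i. P i) \<subseteq> C" by (auto simp: P C_def)
  have "card D = card (C - (\<Union>i. P i)) + card (\<Union>i. Q i)"
    unfolding DQ by (rule card_Un_disjoint) (use finC finQ in \<open>auto simp: C_def Q\<close>)
  moreover have "card (C - (\<Union>i. P i)) + card (\<Union>i. P i) = card C"
    using PC finC by (metis card_Diff_subset card_mono finite_subset le_add_diff_inverse2)
  \<comment> \<open>The gained vectors cancel the lost ones with s + k even, so only the odd gaps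
    survive in the balance.\<close>
  moreover have "(\<Sum>s<k. W s) = (\<Sum>s | s < k \<and> even (s + k). W s) + (\<Sum>s | s < k \<and> odd (s + k). W s)"
  proof -
    have "(\<Sum>s | s < k \<and> even (s + k). W s) + (\<Sum>s | s < k \<and> odd (s + k). W s) =
        sum W ({s. s < k \<and> even (s + k)} \<union> {s. s < k \<and> odd (s + k)})"
      by (rule sum.union_disjoint[symmetric]) (auto intro: finite_subset[of _ "{..<k}"])
    also have "{s. s < k \<and> even (s + k)} \<union> {s. s < k \<and> odd (s + k)} = {..<k}" by auto
    finally show ?thesis ..
  qed
  ultimately have "card D + 2 * CARD('n) * (\<Sum>s | s < k \<and> odd (s + k). W s) = card C"
    using UP UQ by (simp add: algebra_simps)
  then show ?thesis by (simp only: C_def D_def)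
qed

text \<open>The sums V satisfy V (k + 2) = V k + W (k + 1), that is, V (1 - x^2) = x W as series.
  Inserting W = ((1 + x) / (1 - x))^(n-1) and cancelling one factor 1 + x gives the result.\<close>

lemma odd_gap_series:
  fixes W :: "nat \<Rightarrow> nat"
  assumes n: "n \<ge> 2" and W: "Abs_fps (\<lambda>s. real (W s)) * (1 - fps_X) ^ (n - 1) = (1 + fps_X) ^ (n - 1)"
  shows "Abs_fps (\<lambda>k. real (\<Sum>s | s < k \<and> odd (s + k). W s)) * (1 - fps_X) ^ n = fps_X * (1 + fps_X) ^ (n - 2)"
proof -
  define V where "V k = (\<Sum>s | s < k \<and> odd (s + k). W s)" for k
  define F where "F = Abs_fps (\<lambda>k. real (V k))"
  have V0: "V 0 = 0" by (simp add: V_def)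
  have "{s. s < 1 \<and> odd (s + 1)} = {0 :: nat}" by auto
  then have V1: "V (Suc 0) = W 0" by (simp add: V_def)
  have V2: "V (Suc (Suc k)) = W (Suc k) + V k" for k
  proof -
    have "{s. s < Suc (Suc k) \<and> odd (s + Suc (Suc k))} = insert (Suc k) {s. s < k \<and> odd (s + k)}"
      by (auto simp: less_Suc_eq)
    moreover have "finite {s. s < k \<and> odd (s + k)}" by (rule finite_subset[of _ "{..<k}"]) auto
    ultimately show ?thesis by (simp add: V_def)
  qed
  have "F * (1 - fps_X\<^sup>2) = fps_X * Abs_fps (\<lambda>s. real (W s))"
  proof (rule fps_ext)
    fix k
    consider "k = 0" | "k = 1" | j where "k = Suc (Suc j)" by (metis One_nat_def not0_implies_Suc)
    then show "fps_nth (F * (1 - fps_X\<^sup>2)) k = fps_nth (fps_X * Abs_fps (\<lambda>s. real (W s))) k"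
      by cases (simp_all add: F_def right_diff_distrib fps_X_power_mult_right_nth V0 V1 V2)
  qed
  moreover have "1 - fps_X\<^sup>2 = (1 - fps_X) * (1 + fps_X :: real fps)" by (simp add: algebra_simps power2_eq_square)
  ultimately have FW: "F * ((1 - fps_X) * (1 + fps_X)) = fps_X * Abs_fps (\<lambda>s. real (W s))" by (simp only:)
  have pow: "(1 - fps_X :: real fps) ^ n = (1 - fps_X) * (1 - fps_X) ^ (n - 1)"
    "(1 + fps_X :: real fps) ^ (n - 1) = (1 + fps_X) * (1 + fps_X) ^ (n - 2)"
    using n by (simp_all flip: power_Suc add: Suc_diff_Suc numeral_2_eq_2)
  have "(1 + fps_X) * (F * (1 - fps_X) ^ n) = F * ((1 - fps_X) * (1 + fps_X)) * (1 - fps_X) ^ (n - 1)"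
    unfolding pow by (simp only: mult_ac)
  also have "\<dots> = (1 + fps_X) * (fps_X * (1 + fps_X) ^ (n - 2))"
    unfolding FW mult.assoc W unfolding pow by (simp only: mult_ac)
  finally have "(1 + fps_X) * (F * (1 - fps_X) ^ n) = (1 + fps_X) * (fps_X * (1 + fps_X) ^ (n - 2))" .
  moreover have "(1 + fps_X :: real fps) \<noteq> 0"
    using one_plus_X_power_nth[of 1 0] by (metis fps_zero_nth binomial_n_0 of_nat_1 power_one_right zero_neq_one)
  ultimately show ?thesis unfolding F_def V_def by (simp only: mult_cancel_left simp_thms)
qed

text \<open>Connects the coefficients of x (1 + x)^(n-2) with the fraction in the theorem by
  lowering n twice through absorption identities. The factor x accounts for the shift from
  \<open>k\<close> to \<open>Suc k\<close>.\<close>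

lemma binomial_absorb_twice:
  assumes "n \<ge> 2" "k < n"
  shows "real (Suc k) * (real n - real (Suc k)) / (real n - 1) * real (n choose Suc k) = real n * real (n - 2 choose k)"
proof -
  have "Suc k * (n choose Suc k) = n * (n - 1 choose k)" by (rule binomial_absorption)
  then have 1: "real (Suc k) * real (n choose Suc k) = real n * real (n - 1 choose k)" by (metis of_nat_mult)
  have "(n - 1 - k) * (n - 1 choose k) = (n - 1) * (n - 2 choose k)"
    using binomial_absorb_comp[of "n - 1" k] by (simp add: numeral_2_eq_2)
  then have "real (n - 1 - k) * real (n - 1 choose k) = real (n - 1) * real (n - 2 choose k)"
    by (metis of_nat_mult)
  then have 2: "(real n - real (Suc k)) * real (n - 1 choose k) = (real n - 1) * real (n - 2 choose k)"
    using assms by (simp add: of_nat_diff algebra_simps)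
  have "(real n - real (Suc k)) * (real (Suc k) * real (n choose Suc k)) = real n * ((real n - 1) * real (n - 2 choose k))"
    unfolding 1 2[symmetric] by (simp only: mult_ac)
  then show ?thesis using assms(1) by (simp add: field_simps)
qed

lemma binomial_ge_self: "0 < k \<Longrightarrow> k < n \<Longrightarrow> n \<le> n choose k"
proof (induction n arbitrary: k)
  case (Suc n)
  obtain j where j: "k = Suc j" using Suc.prems by (metis gr0_implies_Suc)
  show ?case
  proof (cases "k < n")
    case True
    then have "n \<le> n choose k" using Suc by simp
    moreover have "1 \<le> n choose j" using True j by (simp add: Suc_le_eq)
    ultimately show ?thesis unfolding j binomial_Suc_Suc by linarith
  next
    case False
    then have "k = n" using Suc.prems by simp
    then show ?thesis by simp
  qed
qed simp

text \<open>For 0 < k < n, 4k (n - k) <= n^2 <= 2n (n - 1) bounds the fraction by n, and n is at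
  most n choose k. The square of n choose k is one summand of the Vandermonde sum for 2n choose 2k.
  At both ends the correction vanishes.\<close>

lemma D_coefficient_nonneg:
  assumes n: "n \<ge> 2" and k: "k \<le> n"
  shows "2 * real k * (real n - real k) / (real n - 1) * real (n choose k) \<le> real (2 * n choose (2 * k))"
proof (cases "k = 0 \<or> k = n")
  case False
  then have "n \<le> n choose k" using binomial_ge_self[of k n] k by simp
  then have ge: "real n \<le> real (n choose k)" by simp
  have "0 \<le> (real n - 2 * real k)\<^sup>2" by simp
  then have "4 * (real k * (real n - real k)) \<le> real n * real n"
    by (simp add: power2_eq_square algebra_simps)
  moreover have "real n * real n \<le> real n * (2 * (real n - 1))" using n by (intro mult_left_mono) auto
  ultimately have "2 * real k * (real n - real k) \<le> real n * (real n - 1)" by (simp add: algebra_simps)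
  then have "2 * real k * (real n - real k) / (real n - 1) \<le> real n"
    using n by (simp add: divide_le_eq)
  then have "2 * real k * (real n - real k) / (real n - 1) * real (n choose k) \<le> real (n choose k) * real (n choose k)"
    using ge by (intro mult_right_mono) auto
  also have "\<dots> \<le> real (2 * n choose (2 * k))"
  proof -
    have "(n choose k) * (n choose (2 * k - k)) \<le> (\<Sum>j\<le>2 * k. (n choose j) * (n choose (2 * k - j)))"
      by (rule member_le_sum) auto
    then have "(n choose k) * (n choose k) \<le> 2 * n choose (2 * k)" by (simp add: vandermonde mult_2)
    then show ?thesis by (metis of_nat_le_iff of_nat_mult)
  qed
  finally show ?thesis .
qed auto

section \<open>From the sphere series to the theorem\<close>

lemma coeff_sum_monom: "coeff (\<Sum>k=0..n. monom (c k) k) j = (if j \<le> n then c j else 0)"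
  by (simp add: coeff_sum)

lemma (in lattice_norm) coordinator_poly:
  fixes c :: "nat \<Rightarrow> real"
  assumes dim: "dim L = n"
    and series: "Abs_fps (\<lambda>k. real (card {u \<in> L. N u = real k})) * (1 - fps_X) ^ n =
      Abs_fps (\<lambda>k. if k \<le> n then c k else 0)"
    \<comment> \<open>A nonzero top coefficient pins the degree to \<open>n\<close>, as
      \<open>palindromic\<close> demands.\<close>
    and c: "c n \<noteq> 0" "\<And>k. k \<le> n \<Longrightarrow> c k = c (n - k)" "\<And>k. k \<le> n \<Longrightarrow> 0 \<le> c k"
  shows "let h = (\<Sum>k=0..n. monom (c k) k) in
    is_coordinator_poly L M h \<and>
    (\<forall>K T. coned_unimodular_triangulation L (convex hull M) K T \<longrightarrow> h_poly K = h) \<and>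
    palindromic n h \<and> (\<forall>k. coeff h k \<ge> 0)"
proof -
  define h where "h = (\<Sum>k=0..n. monom (c k) k)"
  have coeff: "coeff h j = (if j \<le> n then c j else 0)" for j
    unfolding h_def by (rule coeff_sum_monom)
  have deg: "degree h = n"
    by (rule antisym) (auto simp: coeff c(1) intro!: degree_le le_degree)
  have coord: "is_coordinator_poly L M h"
    unfolding is_coordinator_poly_def growth_series_divide_iff dim growth_series_norm series
    by (simp add: deg coeff fps_eq_iff)
  have pal: "palindromic n h"
    unfolding palindromic_def
  proof (intro conjI allI impI deg)
    show "coeff h k = coeff h (n - k)" if "k \<le> n" for k
      using c(2)[OF that] that by (simp only: coeff diff_le_self if_True)
  qed
  have hp: "\<forall>K T. coned_unimodular_triangulation L (convex hull M) K T \<longrightarrow> h_poly K = h"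
    using h_poly_eq[OF coord] pal unfolding dim by blast
  have nonneg: "\<forall>k. coeff h k \<ge> 0" using c(3) by (simp add: coeff)
  show ?thesis
    unfolding Let_def h_def[symmetric] by (intro conjI coord hp pal nonneg)
qed

lemma card_of_int_vec_image: "card (of_int_vec ` X) = card X"
  by (rule card_image) (rule inj_on_subset[OF inj_of_int_vec subset_UNIV])

lemma l1_half_of_int_vec: "l1 (of_int_vec z) / 2 = real k \<longleftrightarrow> (\<Sum>i\<in>UNIV. nat \<bar>z i\<bar>) = 2 * k"
proof -
  have "l1 (of_int_vec z) / 2 = real k \<longleftrightarrow> real (\<Sum>i\<in>UNIV. nat \<bar>z i\<bar>) = real (2 * k)"
    unfolding l1_of_int_vec by auto
  then show ?thesis by (simp only: of_nat_eq_iff)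
qed

lemma A_sphere:
  "{u \<in> A_lattice. l1 u / 2 = real k} =
     of_int_vec ` {z. (\<Sum>i\<in>UNIV. z i) = 0 \<and> (\<Sum>i\<in>UNIV. nat \<bar>z i\<bar>) = 2 * k}"
  unfolding A_lattice_eq using l1_half_of_int_vec by blast

lemma C_sphere:
  "{u \<in> C_lattice. l1 u / 2 = real k} = of_int_vec ` {z. (\<Sum>i\<in>UNIV. nat \<bar>z i\<bar>) = 2 * k}"
proof -
  have "even (\<Sum>i\<in>UNIV. z i)" if "(\<Sum>i\<in>UNIV. nat \<bar>z i\<bar>) = 2 * k" for z :: "'n \<Rightarrow> int"
    using even_sum_nat_abs[of z UNIV] that by simp
  then show ?thesis unfolding C_lattice_def D_lattice_eq using l1_half_of_int_vec by blast
qed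

lemma max_half_eq_iff:
  "max (real a) (real b / 2) = real k \<longleftrightarrow> a \<le> k \<and> b \<le> 2 * k \<and> (b = 2 * k \<or> a = k)"
proof (cases "2 * a \<le> b")
  case True
  then have "max (real a) (real b / 2) = real b / 2" by simp
  moreover have "real b / 2 = real k \<longleftrightarrow> b = 2 * k" by linarith
  ultimately show ?thesis using True by auto
next
  case False
  then have "max (real a) (real b / 2) = real a" by simp
  then show ?thesis using False by auto
qed

lemma D_norm_of_int_vec:
  fixes z :: "'n::finite \<Rightarrow> int"
  defines "l \<equiv> \<Sum>i\<in>UNIV. nat \<bar>z i\<bar>"
  shows "D_norm (of_int_vec z) = real k \<longleftrightarrow> (\<forall>i. nat \<bar>z i\<bar> \<le> k) \<and> l \<le> 2 * k \<and> (l = 2 * k \<or> (\<exists>i. nat \<bar>z i\<bar> = k))"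
proof -
  obtain j where j: "infnorm (of_int_vec z) = \<bar>of_int_vec z $ j\<bar>" using infnorm_attained by blast
  then have inf: "infnorm (of_int_vec z) = real (nat \<bar>z j\<bar>)" by simp
  have le: "nat \<bar>z i\<bar> \<le> nat \<bar>z j\<bar>" for i
  proof -
    have "\<bar>of_int_vec z $ i\<bar> \<le> \<bar>of_int_vec z $ j\<bar>"
      using infnorm_le_iff[of "of_int_vec z" "\<bar>of_int_vec z $ j\<bar>"] j by simp
    then show ?thesis by simp
  qed
  have "D_norm (of_int_vec z) = max (real (nat \<bar>z j\<bar>)) (real l / 2)"
    unfolding D_norm_def inf l1_of_int_vec l_def ..
  then have "D_norm (of_int_vec z) = real k \<longleftrightarrow>
      nat \<bar>z j\<bar> \<le> k \<and> l \<le> 2 * k \<and> (l = 2 * k \<or> nat \<bar>z j\<bar> = k)"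
    by (simp only: max_half_eq_iff)
  also have "\<dots> \<longleftrightarrow> (\<forall>i. nat \<bar>z i\<bar> \<le> k) \<and> l \<le> 2 * k \<and> (l = 2 * k \<or> (\<exists>i. nat \<bar>z i\<bar> = k))"
    using le by (meson antisym le_trans)
  finally show ?thesis .
qed

lemma D_sphere:
  "{u \<in> D_lattice. D_norm u = real k} = of_int_vec ` {z. even (\<Sum>i\<in>UNIV. nat \<bar>z i\<bar>) \<and>
     (\<forall>i. nat \<bar>z i\<bar> \<le> k) \<and> (\<Sum>i\<in>UNIV. nat \<bar>z i\<bar>) \<le> 2 * k \<and>
     ((\<Sum>i\<in>UNIV. nat \<bar>z i\<bar>) = 2 * k \<or> (\<exists>i. nat \<bar>z i\<bar> = k))}"
  unfolding D_lattice_eq even_sum_nat_abs[symmetric] using D_norm_of_int_vec by blast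

lemma A_sphere_series:
  assumes "CARD('m::finite) = n + 1"
  shows "Abs_fps (\<lambda>k. real (card {u \<in> (A_lattice :: (real ^ 'm) set). l1 u / 2 = real k})) * (1 - fps_X) ^ n =
    Abs_fps (\<lambda>k. if k \<le> n then real ((n choose k)\<^sup>2) else 0)"
proof -
  have "(real (n choose k))\<^sup>2 = (if k \<le> n then real ((n choose k)\<^sup>2) else 0)" for k
    by (simp add: binomial_eq_0)
  then show ?thesis
    unfolding A_sphere card_of_int_vec_image using A_count_series[where 'm='m, of n] assms by simp
qed

lemma C_sphere_series:
  "Abs_fps (\<lambda>k. real (card {u \<in> (C_lattice :: (real ^ 'n) set). l1 u / 2 = real k})) * (1 - fps_X) ^ CARD('n::finite) =
    Abs_fps (\<lambda>k. if k \<le> CARD('n) then real (2 * CARD('n) choose (2 * k)) else 0)"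
proof -
  have "real (2 * CARD('n) choose (2 * k)) = (if k \<le> CARD('n) then real (2 * CARD('n) choose (2 * k)) else 0)" for k
    by (simp add: binomial_eq_0)
  then show ?thesis
    unfolding C_sphere card_of_int_vec_image using even_count_series[of "UNIV :: 'n set"] by simp
qed

lemma D_sphere_series:
  fixes n :: nat
  assumes card: "CARD('n::finite) = n" and n: "n \<ge> 2"
  shows "Abs_fps (\<lambda>k. real (card {u \<in> (D_lattice :: (real ^ 'n) set). D_norm u = real k})) * (1 - fps_X) ^ n =
    Abs_fps (\<lambda>k. if k \<le> n then real (2 * n choose (2 * k))
      - 2 * real k * (real n - real k) / (real n - 1) * real (n choose k) else 0)"
proof -
  define i0 :: 'n where "i0 = undefined"
  define W where "W s = card {f \<in> (UNIV - {i0}) \<rightarrow>\<^sub>E (UNIV :: int set). (\<Sum>j\<in>UNIV - {i0}. nat \<bar>f j\<bar>) = s}" for s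
  have cardU: "card (UNIV - {i :: 'n}) = n - 1" for i using card by simp
  \<comment> \<open>The count depends only on the number of remaining coordinates. Both series
    become equal after multiplication by a cancellable power of 1 - x, so no bijection between the
    index sets is needed.\<close>
  have Wi: "W s = card {f \<in> (UNIV - {i :: 'n}) \<rightarrow>\<^sub>E (UNIV :: int set). (\<Sum>j\<in>UNIV - {i}. nat \<bar>f j\<bar>) = s}" for i s
  proof -
    have "Abs_fps (\<lambda>s. real (card {f \<in> (UNIV - {i :: 'n}) \<rightarrow>\<^sub>E (UNIV :: int set). (\<Sum>j\<in>UNIV - {i}. nat \<bar>f j\<bar>) = s})) *
        (1 - fps_X) ^ (n - 1) = Abs_fps (\<lambda>s. real (W s)) * (1 - fps_X) ^ (n - 1)"
      using fps_count_PiE_int[of "UNIV - {i}"] fps_count_PiE_int[of "UNIV - {i0}"] by (simp add: cardU W_def)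
    then show ?thesis unfolding fps_eq_iff_mult_one_minus_X_power by (simp add: fps_eq_iff)
  qed
  define V where "V k = (\<Sum>s | s < k \<and> odd (s + k). W s)" for k
  have V: "Abs_fps (\<lambda>k. real (V k)) * (1 - fps_X) ^ n = fps_X * (1 + fps_X) ^ (n - 2)"
    unfolding V_def
    by (rule odd_gap_series[OF n]) (use fps_count_PiE_int[of "UNIV - {i0}"] in \<open>simp add: cardU W_def\<close>)
  let ?D = "Abs_fps (\<lambda>k. real (card {u \<in> (D_lattice :: (real ^ 'n) set). D_norm u = real k}))"
  let ?C = "Abs_fps (\<lambda>k. real (card {u \<in> (C_lattice :: (real ^ 'n) set). l1 u / 2 = real k}))"
  \<comment> \<open>Stated as a sum, as in \<open>D_count\<close>, so that it transfers from natural
    numbers without truncated subtraction.\<close>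
  have balance: "real (card {u \<in> (D_lattice :: (real ^ 'n) set). D_norm u = real k}) + real (2 * n) * real (V k) =
      real (card {u \<in> (C_lattice :: (real ^ 'n) set). l1 u / 2 = real k})" for k
    unfolding D_sphere C_sphere card_of_int_vec_image V_def D_count[OF Wi, of k, symmetric] card
    by (simp only: of_nat_add of_nat_mult)
  have "?D = ?C - fps_const (real (2 * n)) * Abs_fps (\<lambda>k. real (V k))"
  proof (rule fps_ext)
    show "fps_nth ?D k = fps_nth (?C - fps_const (real (2 * n)) * Abs_fps (\<lambda>k. real (V k))) k" for k
      using balance[of k] by (simp only: fps_sub_nth fps_mult_left_const_nth fps_nth_Abs_fps eq_diff_eq)
  qed
  then have "?D * (1 - fps_X) ^ n = ?C * (1 - fps_X) ^ n
      - fps_const (real (2 * n)) * (Abs_fps (\<lambda>k. real (V k)) * (1 - fps_X) ^ n)"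
    by (simp only: left_diff_distrib mult.assoc)
  also have "\<dots> = Abs_fps (\<lambda>k. if k \<le> n then real (2 * n choose (2 * k)) else 0)
      - fps_const (real (2 * n)) * (fps_X * (1 + fps_X) ^ (n - 2))"
    by (simp only: V C_sphere_series[where 'n='n, unfolded card])
  also have "\<dots> = Abs_fps (\<lambda>k. if k \<le> n then real (2 * n choose (2 * k))
      - 2 * real k * (real n - real k) / (real n - 1) * real (n choose k) else 0)"
  proof (rule fps_ext)
    fix k
    show "fps_nth (Abs_fps (\<lambda>k. if k \<le> n then real (2 * n choose (2 * k)) else 0)
      - fps_const (real (2 * n)) * (fps_X * (1 + fps_X) ^ (n - 2))) k =
      fps_nth (Abs_fps (\<lambda>k. if k \<le> n then real (2 * n choose (2 * k))
      - 2 * real k * (real n - real k) / (real n - 1) * real (n choose k) else 0)) k"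
    proof (cases k)
      case (Suc j)
      show ?thesis
      proof (cases "j < n")
        case True
        have "2 * real k * (real n - real k) / (real n - 1) * real (n choose k) =
            2 * (real k * (real n - real k) / (real n - 1) * real (n choose k))" by simp
        also have "\<dots> = real (2 * n) * real (n - 2 choose j)"
          unfolding Suc binomial_absorb_twice[OF n True] by simp
        finally have "2 * real k * (real n - real k) / (real n - 1) * real (n choose k) = real (2 * n) * real (n - 2 choose j)" .
        moreover have "fps_nth (fps_const (real (2 * n)) * (fps_X * (1 + fps_X) ^ (n - 2))) k = real (2 * n) * real (n - 2 choose j)"
          unfolding Suc by (simp add: one_plus_X_power_nth)
        moreover have "k \<le> n" using True Suc by simp
        ultimately show ?thesis by (simp only: fps_sub_nth fps_nth_Abs_fps if_True)
      next
        case False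
        then show ?thesis using n by (simp add: Suc one_plus_X_power_nth binomial_eq_0)
      qed
    qed simp
  qed
  finally show ?thesis .
qed

theorem theorem2:
  fixes n :: nat
  assumes n_pos: "n \<ge> 1"
    and card_m: "CARD('m::finite) = n + 1"
    and card_n: "CARD('n::finite) = n"
  shows
    "(let h = (\<Sum>k=0..n. monom (real ((n choose k)\<^sup>2)) k) in
        is_coordinator_poly (A_lattice :: (real ^ 'm) set) A_generators h \<and>
        (\<forall>K T. coned_unimodular_triangulation (A_lattice :: (real ^ 'm) set) A_polytope K T
           \<longrightarrow> h_poly K = h) \<and>
        palindromic n h \<and> (\<forall>k. coeff h k \<ge> 0)) \<and>
     (let h = (\<Sum>k=0..n. monom (real ((2 * n) choose (2 * k))) k) in
        is_coordinator_poly (C_lattice :: (real ^ 'n) set) C_generators h \<and>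
        (\<forall>K T. coned_unimodular_triangulation (C_lattice :: (real ^ 'n) set) C_polytope K T
           \<longrightarrow> h_poly K = h) \<and>
        palindromic n h \<and> (\<forall>k. coeff h k \<ge> 0)) \<and>
     (n \<ge> 2 \<longrightarrow>
      (let h = (\<Sum>k=0..n. monom (real ((2 * n) choose (2 * k))
                  - 2 * real k * (real n - real k) / (real n - 1) * real (n choose k)) k) in
        is_coordinator_poly (D_lattice :: (real ^ 'n) set) D_generators h \<and>
        (\<forall>K T. coned_unimodular_triangulation (D_lattice :: (real ^ 'n) set) D_polytope K T
           \<longrightarrow> h_poly K = h) \<and>
        palindromic n h \<and> (\<forall>k. coeff h k \<ge> 0)))"
proof (intro conjI impI)
  have sym: "real (2 * n choose (2 * k)) = real (2 * n choose (2 * (n - k)))" if "k \<le> n" for k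
    using binomial_symmetric[of "2 * k" "2 * n"] that by (simp add: diff_mult_distrib2)
  show "let h = (\<Sum>k=0..n. monom (real ((n choose k)\<^sup>2)) k) in
      is_coordinator_poly (A_lattice :: (real ^ 'm) set) A_generators h \<and>
      (\<forall>K T. coned_unimodular_triangulation (A_lattice :: (real ^ 'm) set) A_polytope K T
         \<longrightarrow> h_poly K = h) \<and> palindromic n h \<and> (\<forall>k. coeff h k \<ge> 0)"
  proof (rule lattice_norm.coordinator_poly)
    show "lattice_norm (A_lattice :: (real ^ 'm) set) A_generators (\<lambda>u. l1 u / 2)"
      by (rule A_lattice_norm) (use n_pos card_m in simp)
    show "real ((n choose k)\<^sup>2) = real ((n choose (n - k))\<^sup>2)" if "k \<le> n" for k
      using binomial_symmetric[OF that] by simp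
  qed (use A_sphere_series[OF card_m] card_m in \<open>simp_all add: dim_A_lattice\<close>)
  show "let h = (\<Sum>k=0..n. monom (real ((2 * n) choose (2 * k))) k) in
      is_coordinator_poly (C_lattice :: (real ^ 'n) set) C_generators h \<and>
      (\<forall>K T. coned_unimodular_triangulation (C_lattice :: (real ^ 'n) set) C_polytope K T
         \<longrightarrow> h_poly K = h) \<and> palindromic n h \<and> (\<forall>k. coeff h k \<ge> 0)"
  proof (rule lattice_norm.coordinator_poly[OF C_lattice_norm])
    show "dim (C_lattice :: (real ^ 'n) set) = n" using card_n by (simp add: C_lattice_def dim_D_lattice)
    show "Abs_fps (\<lambda>k. real (card {u \<in> (C_lattice :: (real ^ 'n) set). l1 u / 2 = real k})) * (1 - fps_X) ^ n =
        Abs_fps (\<lambda>k. if k \<le> n then real (2 * n choose (2 * k)) else 0)"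
      using C_sphere_series[where 'n='n] unfolding card_n .
    show "real (2 * n choose (2 * k)) = real (2 * n choose (2 * (n - k)))" if "k \<le> n" for k
      using that by (rule sym)
  qed simp_all
  assume n: "n \<ge> 2"
  have norm: "lattice_norm (D_lattice :: (real ^ 'n) set) D_generators D_norm"
    by (rule D_lattice_norm) (use n card_n in simp)
  show "let h = (\<Sum>k=0..n. monom (real ((2 * n) choose (2 * k))
                - 2 * real k * (real n - real k) / (real n - 1) * real (n choose k)) k) in
      is_coordinator_poly (D_lattice :: (real ^ 'n) set) D_generators h \<and>
      (\<forall>K T. coned_unimodular_triangulation (D_lattice :: (real ^ 'n) set) D_polytope K T
         \<longrightarrow> h_poly K = h) \<and> palindromic n h \<and> (\<forall>k. coeff h k \<ge> 0)"
  proof (rule lattice_norm.coordinator_poly[OF norm])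
    show "dim (D_lattice :: (real ^ 'n) set) = n" using card_n by (simp add: dim_D_lattice)
    show "Abs_fps (\<lambda>k. real (card {u \<in> (D_lattice :: (real ^ 'n) set). D_norm u = real k})) * (1 - fps_X) ^ n =
      Abs_fps (\<lambda>k. if k \<le> n then real (2 * n choose (2 * k))
        - 2 * real k * (real n - real k) / (real n - 1) * real (n choose k) else 0)"
      by (rule D_sphere_series[OF card_n n])
    show "real (2 * n choose (2 * k)) - 2 * real k * (real n - real k) / (real n - 1) * real (n choose k) =
        real (2 * n choose (2 * (n - k)))
        - 2 * real (n - k) * (real n - real (n - k)) / (real n - 1) * real (n choose (n - k))"
      if "k \<le> n" for k
      unfolding sym[OF that] using binomial_symmetric[OF that] that by (simp add: of_nat_diff mult_ac)
    show "0 \<le> real (2 * n choose (2 * k)) - 2 * real k * (real n - real k) / (real n - 1) * real (n choose k)"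
      if "k \<le> n" for k using D_coefficient_nonneg[OF n that] by simp
  qed simp
qed

end
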